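(* Let $T$ be a locally compact Hausdorff space, $\xi_1=(\mathcal{E}_1,p_1,T)$ a Banach bundle and $\xi_2=(\mathcal{E}_2,p_2,T)$ a continuous Banach bundle. Suppose that $\varphi$ is a Banach bundle map from $\xi_1$ to $\xi_2$ with $\varphi(\mathcal{E}_1)=\mathcal{E}_2$ and $\sup_{t\in T}\|\varphi_t\|<\infty$. If there exists a positive constant $m$ with the property that for each $y\in\mathcal{E}_2$ there exists $x\in\mathcal{E}_1$ satisfying $\varphi(x)=y$ and $\|x\|\leq m\|y\|$, then $\tilde{\varphi}(\Gamma_0(\xi_1))=\Gamma_0(\xi_2)$.
   Context: $\mathbb{K}$ is the real or the complex field. A Banach bundle $\xi=(\mathcal{E},p,T)$ consists of a Hausdorff space $T$ (base space), a topological space $\mathcal{E}$ (bundle space, not assumed Hausdorff), and a continuous open surjection $p:\mathcal{E}\to T$ such that each fiber $\mathcal{E}(t)=p^{-1}(t)$ is a Banach space over $\mathbb{K}$ with origin $0_t$, and: addition $\{(x,y)\in\mathcal{E}\times\mathcal{E}: p(x)=p(y)\}\to\mathcal{E}$ and scalar multiplication $\mathbb{K}\times\mathcal{E}\to\mathcal{E}$ are continuous; $x\mapsto\|x\|$ is upper semi-continuous on $\mathcal{E}$; and if $(x_\iota)$ is a net in $\mathcal{E}$ with $p(x_\iota)\to t$ and $\|x_\iota\|\to 0$, then $x_\iota\to 0_t$. The bundle is continuous if $x\mapsto\|x\|$ is continuous on $\mathcal{E}$. A section of $\xi$ is a continuous $f:T\to\mathcal{E}$ with $p(f(t))=t$ for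 all $t\in T$. For $T$ locally compact Hausdorff, $\Gamma_0(\xi)$ is the space of sections vanishing at infinity, i.e. sections $f$ for which $\{t\in T:\|f(t)\|\geq\varepsilon\}$ is compact for every $\varepsilon>0$. A Banach bundle map from $\xi_1$ to $\xi_2$ is a continuous map $\varphi:\mathcal{E}_1\to\mathcal{E}_2$ with $\varphi(p_1^{-1}(t))\subset p_2^{-1}(t)$ for every $t\in T$ whose restriction to each fiber is linear; $\varphi_t:\mathcal{E}_1(t)\to\mathcal{E}_2(t)$ denotes its restriction to the fiber over $t$, a bounded linear operator with operator norm $\|\varphi_t\|$. For a section $f$ of $\xi_1$, $\tilde\varphi(f)$ is the section $t\mapsto\varphi(f(t))$ of $\xi_2$. *)

theory Defs
  imports "HOL-Analysis.Analysis" "HOL-Algebra.Module"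
begin

(* The scalar field is a subfield K of the complex numbers, meant to be
   \<real> (the set Reals) or UNIV; HOL-Algebra modules need it as a ring record. *)

definition scalar_ring :: "complex set \<Rightarrow> complex ring" where
  "scalar_ring K = \<lparr>carrier = K, mult = (*), one = 1, zero = 0, add = (+)\<rparr>"

(* Metric_space asks for nonnegativity and symmetry on the whole type,
   hence the value 0 outside V. *)

definition norm_dist :: "(complex, 'e) module \<Rightarrow> ('e \<Rightarrow> real) \<Rightarrow> 'e \<Rightarrow> 'e \<Rightarrow> real" where
  "norm_dist V N x y = (if x \<in> carrier V \<and> y \<in> carrier V then N (x \<ominus>\<^bsub>V\<^esub> y) else 0)"

(* Only the additive and scalar part of the module record V is relevant;
   its ring multiplication and unit are unconstrained. *)

definition normed_space_over :: "complex set \<Rightarrow> (complex, 'e) module \<Rightarrow> ('e \<Rightarrow> real) \<Rightarrow> bool" where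
  "normed_space_over K V N \<longleftrightarrow>
     Module.module (scalar_ring K) V \<and>
     (\<forall>x \<in> carrier V. 0 \<le> N x) \<and>
     (\<forall>x \<in> carrier V. N x = 0 \<longleftrightarrow> x = \<zero>\<^bsub>V\<^esub>) \<and>
     (\<forall>c \<in> K. \<forall>x \<in> carrier V. N (c \<odot>\<^bsub>V\<^esub> x) = cmod c * N x) \<and>
     (\<forall>x \<in> carrier V. \<forall>y \<in> carrier V. N (x \<oplus>\<^bsub>V\<^esub> y) \<le> N x + N y)"

definition banach_space_over :: "complex set \<Rightarrow> (complex, 'e) module \<Rightarrow> ('e \<Rightarrow> real) \<Rightarrow> bool" where
  "banach_space_over K V N \<longleftrightarrow>
     normed_space_over K V N \<and> Metric_space.mcomplete (carrier V) (norm_dist V N)"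

lemma Metric_space_norm_dist:
  assumes "normed_space_over K V N" and "1 \<in> K" "-1 \<in> K"
  shows "Metric_space (carrier V) (norm_dist V N)"
proof -
  interpret V: Module.module "scalar_ring K" V
    using assms(1) by (simp add: normed_space_over_def)
  have nonneg: "0 \<le> N x" if "x \<in> carrier V" for x
    using assms(1) that by (simp add: normed_space_over_def)
  have zero: "N x = 0 \<longleftrightarrow> x = \<zero>\<^bsub>V\<^esub>" if "x \<in> carrier V" for x
    using assms(1) that by (simp add: normed_space_over_def)
  have scale: "N (c \<odot>\<^bsub>V\<^esub> x) = cmod c * N x" if "c \<in> K" "x \<in> carrier V" for c x
    using assms(1) that by (simp add: normed_space_over_def)
  have tri: "N (x \<oplus>\<^bsub>V\<^esub> y) \<le> N x + N y" if "x \<in> carrier V" "y \<in> carrier V" for x y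
    using assms(1) that by (simp add: normed_space_over_def)
  have neg: "N (\<ominus>\<^bsub>V\<^esub> x) = N x" if x: "x \<in> carrier V" for x
  proof -
    have one: "\<one>\<^bsub>scalar_ring K\<^esub> = 1" "1 \<in> carrier (scalar_ring K)" "-1 \<in> carrier (scalar_ring K)"
      using assms(2,3) by (auto simp: scalar_ring_def)
    have zero': "\<zero>\<^bsub>scalar_ring K\<^esub> = -1 \<oplus>\<^bsub>scalar_ring K\<^esub> 1"
      by (simp add: scalar_ring_def)
    have "((-1) \<odot>\<^bsub>V\<^esub> x) \<oplus>\<^bsub>V\<^esub> x = ((-1) \<oplus>\<^bsub>scalar_ring K\<^esub> 1) \<odot>\<^bsub>V\<^esub> x"
      using V.smult_l_distr[of "-1" 1 x] V.smult_one[OF x] one x by simp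
    also have "\<dots> = \<zero>\<^bsub>V\<^esub>"
      using V.smult_l_null[OF x] zero' by simp
    finally have "\<ominus>\<^bsub>V\<^esub> x = (-1) \<odot>\<^bsub>V\<^esub> x"
      using V.M.minus_equality one x by auto
    then show ?thesis
      using scale[of "-1" x] assms(3) x by simp
  qed
  have swap: "N (x \<ominus>\<^bsub>V\<^esub> y) = N (y \<ominus>\<^bsub>V\<^esub> x)" if "x \<in> carrier V" "y \<in> carrier V" for x y
  proof -
    have "\<ominus>\<^bsub>V\<^esub> (x \<ominus>\<^bsub>V\<^esub> y) = y \<ominus>\<^bsub>V\<^esub> x"
      using that by (simp add: a_minus_def V.M.minus_add V.M.a_comm)
    then show ?thesis
      using neg[of "x \<ominus>\<^bsub>V\<^esub> y"] that by simp
  qed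
  show ?thesis
  proof
    show "0 \<le> norm_dist V N x y" for x y
      by (simp add: norm_dist_def nonneg)
    show "norm_dist V N x y = norm_dist V N y x" for x y
      by (auto simp: norm_dist_def swap)
    show "norm_dist V N x y = 0 \<longleftrightarrow> x = y" if "x \<in> carrier V" "y \<in> carrier V" for x y
    proof -
      have "x \<ominus>\<^bsub>V\<^esub> y \<oplus>\<^bsub>V\<^esub> y = x"
        using that by (simp add: a_minus_def V.M.a_assoc V.M.l_neg)
      moreover have "y \<ominus>\<^bsub>V\<^esub> y = \<zero>\<^bsub>V\<^esub>"
        using that by (simp add: a_minus_def V.M.r_neg)
      ultimately show ?thesis
        using that by (auto simp: norm_dist_def zero)
    qed
    show "norm_dist V N x z \<le> norm_dist V N x y + norm_dist V N y z"
      if "x \<in> carrier V" "y \<in> carrier V" "z \<in> carrier V" for x y z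
    proof -
      have "(x \<ominus>\<^bsub>V\<^esub> y) \<oplus>\<^bsub>V\<^esub> (y \<ominus>\<^bsub>V\<^esub> z) = x \<ominus>\<^bsub>V\<^esub> z"
        using that by (simp add: a_minus_def V.M.a_assoc V.M.r_neg1)
      then show ?thesis
        using tri[of "x \<ominus>\<^bsub>V\<^esub> y" "y \<ominus>\<^bsub>V\<^esub> z"] that by (simp add: norm_dist_def)
    qed
  qed
qed

record ('t, 'e) bundle_data =
  bundle_space :: "'e topology"
  bundle_proj :: "'e \<Rightarrow> 't"
  base_space :: "'t topology"
  fiber :: "'t \<Rightarrow> (complex, 'e) module"
  fnorm :: "'e \<Rightarrow> real"

(* The convergence axiom quantifies over filters F on the bundle space instead of
   nets: a net induces its eventuality filter, every proper filter is of this form,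
   and for the trivial filter the clause is trivially true. *)

definition banach_bundle :: "complex set \<Rightarrow> ('t, 'e) bundle_data \<Rightarrow> bool" where
  "banach_bundle K \<xi> \<longleftrightarrow>
     (let E = bundle_space \<xi>; p = bundle_proj \<xi>; T = base_space \<xi>; V = fiber \<xi>; N = fnorm \<xi> in
        Hausdorff_space T \<and>
        continuous_map E T p \<and> open_map E T p \<and> p ` topspace E = topspace T \<and>
        (\<forall>t \<in> topspace T. carrier (V t) = {x \<in> topspace E. p x = t} \<and> banach_space_over K (V t) N) \<and>
        continuous_map (subtopology (prod_topology E E) {(x, y). p x = p y}) E
          (\<lambda>(x, y). x \<oplus>\<^bsub>V (p x)\<^esub> y) \<and>
        continuous_map (prod_topology (top_of_set K) E) E (\<lambda>(c, x). c \<odot>\<^bsub>V (p x)\<^esub> x) \<and>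
        (\<forall>a. openin E {x \<in> topspace E. N x < a}) \<and>
        (\<forall>F t. t \<in> topspace T \<and> eventually (\<lambda>x. x \<in> topspace E) F \<and>
               limitin T p t F \<and> (N \<longlongrightarrow> 0) F \<longrightarrow>
               limitin E (\<lambda>x. x) \<zero>\<^bsub>V t\<^esub> F))"

definition continuous_banach_bundle :: "complex set \<Rightarrow> ('t, 'e) bundle_data \<Rightarrow> bool" where
  "continuous_banach_bundle K \<xi> \<longleftrightarrow>
     banach_bundle K \<xi> \<and> continuous_map (bundle_space \<xi>) euclideanreal (fnorm \<xi>)"

(* Sections are functions on the base space only, so they are made
   extensional: equal to undefined off topspace. *)

definition bundle_sections :: "('t, 'e) bundle_data \<Rightarrow> ('t \<Rightarrow> 'e) set" where
  "bundle_sections \<xi> =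
     {f \<in> extensional (topspace (base_space \<xi>)).
        continuous_map (base_space \<xi>) (bundle_space \<xi>) f \<and>
        (\<forall>t \<in> topspace (base_space \<xi>). bundle_proj \<xi> (f t) = t)}"

definition Gamma0 :: "('t, 'e) bundle_data \<Rightarrow> ('t \<Rightarrow> 'e) set" where
  "Gamma0 \<xi> =
     {f \<in> bundle_sections \<xi>.
        \<forall>\<epsilon>>0. compactin (base_space \<xi>) {t \<in> topspace (base_space \<xi>). \<epsilon> \<le> fnorm \<xi> (f t)}}"

definition banach_bundle_map ::
    "complex set \<Rightarrow> ('t, 'e1) bundle_data \<Rightarrow> ('t, 'e2) bundle_data \<Rightarrow> ('e1 \<Rightarrow> 'e2) \<Rightarrow> bool" where
  "banach_bundle_map K \<xi>1 \<xi>2 \<phi> \<longleftrightarrow>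
     continuous_map (bundle_space \<xi>1) (bundle_space \<xi>2) \<phi> \<and>
     (\<forall>t \<in> topspace (base_space \<xi>1).
        \<phi> ` carrier (fiber \<xi>1 t) \<subseteq> carrier (fiber \<xi>2 t) \<and>
        (\<forall>x \<in> carrier (fiber \<xi>1 t). \<forall>y \<in> carrier (fiber \<xi>1 t).
           \<phi> (x \<oplus>\<^bsub>fiber \<xi>1 t\<^esub> y) = \<phi> x \<oplus>\<^bsub>fiber \<xi>2 t\<^esub> \<phi> y) \<and>
        (\<forall>c \<in> K. \<forall>x \<in> carrier (fiber \<xi>1 t).
           \<phi> (c \<odot>\<^bsub>fiber \<xi>1 t\<^esub> x) = c \<odot>\<^bsub>fiber \<xi>2 t\<^esub> \<phi> x))"

(* Valued in ennreal, so that suprema are meaningful without a boundedness assumption. *)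

definition fiber_onorm ::
    "('t, 'e1) bundle_data \<Rightarrow> ('t, 'e2) bundle_data \<Rightarrow> ('e1 \<Rightarrow> 'e2) \<Rightarrow> 't \<Rightarrow> ennreal" where
  "fiber_onorm \<xi>1 \<xi>2 \<phi> t =
     (SUP x \<in> {x \<in> carrier (fiber \<xi>1 t). fnorm \<xi>1 x \<le> 1}. ennreal (fnorm \<xi>2 (\<phi> x)))"

definition induced_map :: "('t, 'e1) bundle_data \<Rightarrow> ('e1 \<Rightarrow> 'e2) \<Rightarrow> ('t \<Rightarrow> 'e1) \<Rightarrow> 't \<Rightarrow> 'e2" where
  "induced_map \<xi>1 \<phi> f = (\<lambda>t \<in> topspace (base_space \<xi>1). \<phi> (f t))"

end

theory Submission
  imports Defs
begin

text \<open>
  Only the lifting of sections needs an argument, and it is a Michael-type selection. A set-theoretic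
  family \<open>f\<close> with \<open>\<phi> (f t) = g t\<close> and \<open>\<parallel>f t\<parallel> \<le> m \<parallel>g t\<parallel>\<close> exists by assumption. Such a family is
  improved step by step, halving a defect of continuity \<open>e\<close> and moving \<open>f\<close> by at most \<open>3 e\<close>: locally,
  points of the bundle near \<open>f t\<close> are corrected to lie over \<open>g\<close> exactly, at the cost of \<open>m\<close> times the
  error in \<open>\<xi>2\<close>; these local families are glued by convex combinations over the compact set where
  \<open>\<parallel>g\<parallel>\<close> is not small. Off that set the bound \<open>\<parallel>f\<parallel> \<le> (m + 1) \<parallel>g\<parallel>\<close> makes the defect small
  automatically, so no paracompactness of the base is needed. The uniform limit is continuous and
  inherits the norm bound, hence vanishes at infinity.
\<close>

text \<open>The construction does not start from continuous local sections of \<xi>1 through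
  prescribed points. Open subsets of the bundle space take their place: the projection is open, so
  such a set has points over every base point near \<open>t\<close>, and two of them that meet the
  fiber over \<open>t\<close> can be compared over a common neighbourhood of \<open>t\<close>. The
  norm of \<xi>1 is only upper semi-continuous, so strict upper bounds on norms and distances
  persist nearby while lower bounds may not. Every approximation is therefore phrased as a strict
  upper bound. A lower bound is essential where \<open>(m + 1) * Y.N (g s)\<close> must not drop as
  \<open>s\<close> leaves \<open>t\<close>; there the continuity of the norm of \<xi>2 enters. The
  defect can be halved because the correction starts in a neighbourhood of the value
  \<open>f t\<close> itself, which may be as small as desired; the old defect only limits how far
  the family moves. The factor 3 pays for two passages of slightly more than \<open>e\<close> each
  and for the correction, and since the defects halve, all movements from one step on sum to 6 times
  its defect.\<close>

lemma openin_in: "openin X U \<Longrightarrow> x \<in> U \<Longrightarrow> x \<in> topspace X"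
  using openin_subset by blast

lemma convex_less:
  fixes c :: real
  assumes "0 \<le> c" "c \<le> 1" "a < e" "b < e"
  shows "(1 - c) * a + c * b < e"
  using convex_bound_lt[of a e b "1 - c" c] assms by simp

text \<open>The closed set \<open>D\<close> inside \<open>W\<close> says more than vanishing off
  \<open>W\<close>: a point outside \<open>W\<close> has the open complement of \<open>D\<close> as
  a neighbourhood on which \<psi> is 0. Likewise \<psi> is 1 on an open set, not just at one point,
  so gluing with \<psi> leaves a family unchanged near points of either kind.\<close>

definition bump_data :: "'a topology \<Rightarrow> 'a set \<Rightarrow> ('a \<Rightarrow> real) \<Rightarrow> 'a set \<Rightarrow> 'a set \<Rightarrow> bool" where
  "bump_data X W \<psi> A D \<longleftrightarrow>
     continuous_map X euclideanreal \<psi> \<and> (\<forall>s\<in>topspace X. 0 \<le> \<psi> s \<and> \<psi> s \<le> 1) \<and>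
     openin X A \<and> A \<subseteq> W \<and> (\<forall>s\<in>A. \<psi> s = 1) \<and>
     closedin X D \<and> D \<subseteq> W \<and> (\<forall>s\<in>topspace X - D. \<psi> s = 0)"

lemma bump_data_exists:
  assumes "completely_regular_space X" "openin X W" "x \<in> W"
  shows "\<exists>\<psi> A D. x \<in> A \<and> bump_data X W \<psi> A D"
proof -
  obtain f where f: "continuous_map X euclideanreal f" "f x = 0" "f ` (topspace X - W) \<subseteq> {1::real}"
    using assms unfolding completely_regular_space_alt' by blast
  \<comment> \<open>Clipping \<open>2 - 3 * f s\<close> to the unit interval gives 1 where
    \<open>f\<close> is at most 1/3 and 0 where it is at least 2/3; the two levels leave room for an
    open \<open>A\<close> and a closed \<open>D\<close>.\<close>
  define \<psi> where "\<psi> s = max 0 (min 1 (2 - 3 * f s))" for s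
  define A where "A = {s \<in> topspace X. f s \<in> {..<1/3}}"
  define D where "D = {s \<in> topspace X. f s \<in> {..2/3}}"
  have x: "x \<in> topspace X" by (rule openin_in[OF assms(2,3)])
  have W: "s \<in> W" if "s \<in> topspace X" "f s \<noteq> 1" for s using f(3) that by blast
  have "continuous_map X euclideanreal \<psi>"
    unfolding \<psi>_def by (intro continuous_intros continuous_map_real_max continuous_map_real_min f(1))
  moreover have "openin X A"
    unfolding A_def by (rule openin_continuous_map_preimage[OF f(1)]) simp
  moreover have "closedin X D"
    unfolding D_def by (rule closedin_continuous_map_preimage[OF f(1)]) simp
  ultimately have "bump_data X W \<psi> A D"
    unfolding bump_data_def using W by (auto simp: \<psi>_def A_def D_def)
  moreover have "x \<in> A" using x f(2) by (simp add: A_def)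
  ultimately show ?thesis by blast
qed

section \<open>Fiberwise metric and convex combinations in a Banach bundle\<close>

locale bundled_banach_spaces =
  fixes K :: "complex set" and \<xi> :: "('t, 'e) bundle_data"
  assumes scalars: "K = \<real> \<or> K = UNIV"
    and banach: "banach_bundle K \<xi>"
begin

abbreviation "E \<equiv> bundle_space \<xi>"
abbreviation "p \<equiv> bundle_proj \<xi>"
abbreviation "T \<equiv> base_space \<xi>"
abbreviation "V \<equiv> fiber \<xi>"
abbreviation "N \<equiv> fnorm \<xi>"

text \<open>The fiber is read off from the first argument, so that \<open>d\<close> applies to
  points moving over the base. It is a metric on each fiber; across different fibers its value
  carries no meaning.\<close>

definition d :: "'e \<Rightarrow> 'e \<Rightarrow> real" where
  "d x y = N (x \<ominus>\<^bsub>V (p x)\<^esub> y)"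

definition comb :: "real \<Rightarrow> 'e \<Rightarrow> 'e \<Rightarrow> 'e" where
  "comb c x y = (complex_of_real (1 - c) \<odot>\<^bsub>V (p x)\<^esub> x) \<oplus>\<^bsub>V (p x)\<^esub> (complex_of_real c \<odot>\<^bsub>V (p x)\<^esub> y)"

lemma of_real_scalars [simp]: "complex_of_real c \<in> K"
  using scalars by auto

lemma one_scalars: "1 \<in> K" "-1 \<in> K"
  using scalars by auto

lemma proj_continuous: "continuous_map E T p"
  and proj_open: "open_map E T p"
  and proj_surj: "p ` topspace E = topspace T"
  and add_continuous: "continuous_map (subtopology (prod_topology E E) {(x, y). p x = p y}) E
          (\<lambda>(x, y). x \<oplus>\<^bsub>V (p x)\<^esub> y)"
  and scale_continuous: "continuous_map (prod_topology (top_of_set K) E) E (\<lambda>(c, x). c \<odot>\<^bsub>V (p x)\<^esub> x)"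
  and open_norm_less: "openin E {x \<in> topspace E. N x < a}"
  using banach unfolding banach_bundle_def Let_def by blast+

lemma null_filter_limit:
  assumes "t \<in> topspace T" "eventually (\<lambda>x. x \<in> topspace E) F" "limitin T p t F" "(N \<longlongrightarrow> 0) F"
  shows "limitin E (\<lambda>x. x) \<zero>\<^bsub>V t\<^esub> F"
  using banach assms unfolding banach_bundle_def Let_def by blast

lemma carrier_fiber: "t \<in> topspace T \<Longrightarrow> carrier (V t) = {x \<in> topspace E. p x = t}"
  and banach_fiber: "t \<in> topspace T \<Longrightarrow> banach_space_over K (V t) N"
  using banach unfolding banach_bundle_def Let_def by blast+

lemma proj_in [simp]: "x \<in> topspace E \<Longrightarrow> p x \<in> topspace T"
  using proj_surj by auto

lemma normed_fiber: "t \<in> topspace T \<Longrightarrow> normed_space_over K (V t) N"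
  using banach_fiber by (simp add: banach_space_over_def)

lemma module_fiber: "t \<in> topspace T \<Longrightarrow> Module.module (scalar_ring K) (V t)"
  using normed_fiber by (simp add: normed_space_over_def)

lemma metric_fiber: "t \<in> topspace T \<Longrightarrow> Metric_space {x \<in> topspace E. p x = t} (norm_dist (V t) N)"
  using Metric_space_norm_dist[OF normed_fiber one_scalars] carrier_fiber by metis

lemma norm_dist_eq:
  "\<lbrakk>x \<in> topspace E; y \<in> topspace E; p x = t; p y = t\<rbrakk> \<Longrightarrow> norm_dist (V t) N x y = d x y"
  using carrier_fiber[of t] by (auto simp: norm_dist_def d_def)

lemma d_nonneg:
  assumes "x \<in> topspace E" "y \<in> topspace E" "p x = p y"
  shows "0 \<le> d x y"
  using Metric_space.nonneg[OF metric_fiber] norm_dist_eq assms by (metis proj_in)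

lemma d_same [simp]: "x \<in> topspace E \<Longrightarrow> d x x = 0"
  using Metric_space.mdist_zero[OF metric_fiber[of "p x"], of x] norm_dist_eq[of x x "p x"] by simp

lemma d_commute:
  assumes "x \<in> topspace E" "y \<in> topspace E" "p x = p y"
  shows "d x y = d y x"
  using Metric_space.commute[OF metric_fiber] norm_dist_eq assms by (metis proj_in)

lemma d_eq_0:
  assumes "x \<in> topspace E" "y \<in> topspace E" "p x = p y" "d x y = 0"
  shows "x = y"
  using Metric_space.zero[OF metric_fiber[OF proj_in[OF assms(2)]], of x y] norm_dist_eq[OF assms(1,2,3) refl] assms
  by (metis (mono_tags, lifting) mem_Collect_eq)

lemma d_triangle:
  assumes "x \<in> topspace E" "y \<in> topspace E" "z \<in> topspace E" "p x = p y" "p z = p y"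
  shows "d x z \<le> d x y + d y z"
  using Metric_space.triangle[OF metric_fiber[OF proj_in[OF assms(2)]], of x y z]
  unfolding norm_dist_eq[OF assms(1,2,4) refl] norm_dist_eq[OF assms(1,3,4,5)] norm_dist_eq[OF assms(2,3) refl assms(5)]
  using assms by blast

lemma zero_in:
  assumes "t \<in> topspace T"
  shows "\<zero>\<^bsub>V t\<^esub> \<in> topspace E" "p \<zero>\<^bsub>V t\<^esub> = t"
proof -
  interpret M: Module.module "scalar_ring K" "V t" using module_fiber assms by blast
  show "\<zero>\<^bsub>V t\<^esub> \<in> topspace E" "p \<zero>\<^bsub>V t\<^esub> = t"
    using M.M.zero_closed carrier_fiber[OF assms] by auto
qed

lemma minus_in:
  assumes "x \<in> topspace E" "y \<in> topspace E" "p x = t" "p y = t"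
  shows "x \<ominus>\<^bsub>V t\<^esub> y \<in> topspace E" "p (x \<ominus>\<^bsub>V t\<^esub> y) = t"
    "y \<oplus>\<^bsub>V t\<^esub> (x \<ominus>\<^bsub>V t\<^esub> y) = x"
    "x \<ominus>\<^bsub>V t\<^esub> y = x \<oplus>\<^bsub>V t\<^esub> ((-1) \<odot>\<^bsub>V t\<^esub> y)"
proof -
  have t: "t \<in> topspace T" using assms by auto
  interpret M: Module.module "scalar_ring K" "V t" using module_fiber t by blast
  have c: "x \<in> carrier (V t)" "y \<in> carrier (V t)" using assms carrier_fiber[OF t] by auto
  have "x \<ominus>\<^bsub>V t\<^esub> y \<in> carrier (V t)" using c by simp
  then show "x \<ominus>\<^bsub>V t\<^esub> y \<in> topspace E" "p (x \<ominus>\<^bsub>V t\<^esub> y) = t"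
    using carrier_fiber[OF t] by auto
  show "y \<oplus>\<^bsub>V t\<^esub> (x \<ominus>\<^bsub>V t\<^esub> y) = x"
    using c by (metis M.M.a_comm M.M.add.m_assoc M.M.add.r_inv_ex M.M.a_inv_closed M.M.l_neg M.M.minus_eq M.M.r_zero)
  have one: "\<one>\<^bsub>scalar_ring K\<^esub> = 1" "1 \<in> carrier (scalar_ring K)" "-1 \<in> carrier (scalar_ring K)"
    using one_scalars by (auto simp: scalar_ring_def)
  have "(-1) \<oplus>\<^bsub>scalar_ring K\<^esub> 1 = \<zero>\<^bsub>scalar_ring K\<^esub>" by (simp add: scalar_ring_def)
  then have "((-1) \<odot>\<^bsub>V t\<^esub> y) \<oplus>\<^bsub>V t\<^esub> y = \<zero>\<^bsub>V t\<^esub>"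
    using M.smult_l_distr[of "-1" 1 y] M.smult_one[OF c(2)] M.smult_l_null[OF c(2)] one c by simp
  then have "\<ominus>\<^bsub>V t\<^esub> y = (-1) \<odot>\<^bsub>V t\<^esub> y"
    using M.M.minus_equality one c by auto
  then show "x \<ominus>\<^bsub>V t\<^esub> y = x \<oplus>\<^bsub>V t\<^esub> ((-1) \<odot>\<^bsub>V t\<^esub> y)"
    by (simp add: a_minus_def)
qed

lemma N_nonneg: "x \<in> topspace E \<Longrightarrow> 0 \<le> N x"
  using normed_fiber[OF proj_in, of x] carrier_fiber[OF proj_in, of x] unfolding normed_space_over_def by blast

lemma N_zero: "t \<in> topspace T \<Longrightarrow> N \<zero>\<^bsub>V t\<^esub> = 0"
  using normed_fiber[of t] carrier_fiber[of t] zero_in[of t] unfolding normed_space_over_def by blast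

lemma d_zero:
  assumes "x \<in> topspace E" "p x = t"
  shows "d x \<zero>\<^bsub>V t\<^esub> = N x"
proof -
  have t: "t \<in> topspace T" using assms by auto
  interpret M: Module.module "scalar_ring K" "V t" using module_fiber t by blast
  have c: "x \<in> carrier (V t)" using assms carrier_fiber[OF t] by auto
  then have "x \<ominus>\<^bsub>V t\<^esub> \<zero>\<^bsub>V t\<^esub> = x" by (simp add: a_minus_def)
  then show ?thesis using assms by (simp add: d_def)
qed

lemma N_le:
  assumes "x \<in> topspace E" "y \<in> topspace E" "p x = p y"
  shows "N x \<le> d x y + N y"
proof -
  have z: "\<zero>\<^bsub>V (p y)\<^esub> \<in> topspace E" "p \<zero>\<^bsub>V (p y)\<^esub> = p y"
    using zero_in proj_in[OF assms(2)] by blast+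
  show ?thesis
    using d_triangle[OF assms(1,2) z(1) assms(3) z(2)]
    unfolding d_zero[OF assms(1,3)] d_zero[OF assms(2) refl] .
qed

lemma d_le:
  assumes "x \<in> topspace E" "y \<in> topspace E" "p x = p y"
  shows "d x y \<le> N x + N y"
proof -
  have z: "\<zero>\<^bsub>V (p y)\<^esub> \<in> topspace E" "p \<zero>\<^bsub>V (p y)\<^esub> = p y"
    using zero_in proj_in[OF assms(2)] by blast+
  show ?thesis
    using d_triangle[OF assms(1) z(1) assms(2)] z(2) assms(3)
    unfolding d_zero[OF assms(1,3)] d_zero[OF assms(2) refl] d_commute[OF z(1) assms(2) z(2)] by argo
qed

lemma comb_in:
  assumes "x \<in> topspace E" "y \<in> topspace E" "p x = p y"
  shows "comb c x y \<in> topspace E" "p (comb c x y) = p y"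
proof -
  have t: "p x \<in> topspace T" using assms by auto
  interpret M: Module.module "scalar_ring K" "V (p x)" using module_fiber t by blast
  have c: "x \<in> carrier (V (p x))" "y \<in> carrier (V (p x))" using assms carrier_fiber[OF t] by auto
  have "c \<odot>\<^bsub>V (p x)\<^esub> z \<in> carrier (V (p x))" if "c \<in> K" "z \<in> carrier (V (p x))" for c z
    using that M.smult_closed by (simp add: scalar_ring_def)
  then have "comb c x y \<in> carrier (V (p x))" using c by (simp add: comb_def del: of_real_diff)
  then show "comb c x y \<in> topspace E" "p (comb c x y) = p y"
    using carrier_fiber[OF t] assms by auto
qed

text \<open>The difference of two combinations with equal weights is the combination of the
  differences. With \<open>comb_same\<close> and the zero vector this one estimate also yields
  convexity of balls and of the norm.\<close>

lemma d_comb: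
  assumes "x \<in> topspace E" "y \<in> topspace E" "x' \<in> topspace E" "y' \<in> topspace E"
    "p x = t" "p y = t" "p x' = t" "p y' = t" and c: "0 \<le> c" "c \<le> 1"
  shows "d (comb c x y) (comb c x' y') \<le> (1 - c) * d x x' + c * d y y'"
proof -
  have t: "t \<in> topspace T" using assms by auto
  interpret M: Module.module "scalar_ring K" "V t" using module_fiber t by blast
  have car: "x \<in> carrier (V t)" "y \<in> carrier (V t)" "x' \<in> carrier (V t)" "y' \<in> carrier (V t)"
    using assms carrier_fiber[OF t] by auto
  have s[simp]: "complex_of_real c \<in> carrier (scalar_ring K)" "complex_of_real (1 - c) \<in> carrier (scalar_ring K)"
    unfolding scalar_ring_def by (simp_all del: of_real_diff)
  let ?a = "complex_of_real (1 - c)" and ?b = "complex_of_real c"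
  have dist: "a \<odot>\<^bsub>V t\<^esub> (u \<ominus>\<^bsub>V t\<^esub> v) = (a \<odot>\<^bsub>V t\<^esub> u) \<ominus>\<^bsub>V t\<^esub> (a \<odot>\<^bsub>V t\<^esub> v)"
    if "a \<in> carrier (scalar_ring K)" "u \<in> carrier (V t)" "v \<in> carrier (V t)" for a u v
    using that by (simp add: a_minus_def M.smult_r_distr M.smult_r_minus)
  have cl: "?a \<odot>\<^bsub>V t\<^esub> x \<in> carrier (V t)" "?b \<odot>\<^bsub>V t\<^esub> y \<in> carrier (V t)"
    "?a \<odot>\<^bsub>V t\<^esub> x' \<in> carrier (V t)" "?b \<odot>\<^bsub>V t\<^esub> y' \<in> carrier (V t)"
    using car s by (auto simp del: of_real_diff)
  have shuffle: "(u \<oplus>\<^bsub>V t\<^esub> v) \<ominus>\<^bsub>V t\<^esub> (u' \<oplus>\<^bsub>V t\<^esub> v') = (u \<ominus>\<^bsub>V t\<^esub> u') \<oplus>\<^bsub>V t\<^esub> (v \<ominus>\<^bsub>V t\<^esub> v')"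
    if "u \<in> carrier (V t)" "v \<in> carrier (V t)" "u' \<in> carrier (V t)" "v' \<in> carrier (V t)" for u v u' v'
    using that by (simp add: a_minus_def M.M.minus_add M.M.a_ac)
  have "d (comb c x y) (comb c x' y') = N (comb c x y \<ominus>\<^bsub>V t\<^esub> comb c x' y')"
    using comb_in(2) assms by (simp add: d_def)
  also have "comb c x y \<ominus>\<^bsub>V t\<^esub> comb c x' y'
      = (?a \<odot>\<^bsub>V t\<^esub> (x \<ominus>\<^bsub>V t\<^esub> x')) \<oplus>\<^bsub>V t\<^esub> (?b \<odot>\<^bsub>V t\<^esub> (y \<ominus>\<^bsub>V t\<^esub> y'))"
    using cl car assms by (simp add: comb_def dist shuffle del: of_real_diff)
  also have "N \<dots> \<le> N (?a \<odot>\<^bsub>V t\<^esub> (x \<ominus>\<^bsub>V t\<^esub> x')) + N (?b \<odot>\<^bsub>V t\<^esub> (y \<ominus>\<^bsub>V t\<^esub> y'))"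
  proof -
    have tri: "\<And>u v. u \<in> carrier (V t) \<Longrightarrow> v \<in> carrier (V t) \<Longrightarrow> N (u \<oplus>\<^bsub>V t\<^esub> v) \<le> N u + N v"
      using normed_fiber[OF t] unfolding normed_space_over_def by blast
    show ?thesis
      by (rule tri) (use car s in \<open>auto simp del: of_real_diff\<close>)
  qed
  also have "\<dots> = cmod ?a * N (x \<ominus>\<^bsub>V t\<^esub> x') + cmod ?b * N (y \<ominus>\<^bsub>V t\<^esub> y')"
    using normed_fiber[OF t] car of_real_scalars[of c] of_real_scalars[of "1-c"] unfolding normed_space_over_def
    by (simp del: of_real_diff)
  also have "\<dots> = (1 - c) * d x x' + c * d y y'"
    using c assms by (simp add: d_def del: of_real_diff)
  finally show ?thesis .
qed

lemma comb_same:
  assumes "x \<in> topspace E"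
  shows "comb c x x = x"
proof -
  have t: "p x \<in> topspace T" using assms by auto
  interpret M: Module.module "scalar_ring K" "V (p x)" using module_fiber t by blast
  have car: "x \<in> carrier (V (p x))"
    using assms carrier_fiber[OF t] by auto
  have s: "complex_of_real c \<in> carrier (scalar_ring K)" "complex_of_real (1 - c) \<in> carrier (scalar_ring K)"
    unfolding scalar_ring_def by (simp_all del: of_real_diff)
  have "complex_of_real (1 - c) \<oplus>\<^bsub>scalar_ring K\<^esub> complex_of_real c = \<one>\<^bsub>scalar_ring K\<^esub>"
    by (simp add: scalar_ring_def)
  then show ?thesis
    using M.smult_l_distr[OF s(2,1) car] M.smult_one[OF car] by (simp add: comb_def del: of_real_diff)
qed

lemma comb_0_1:
  assumes "x \<in> topspace E" "y \<in> topspace E" "p x = p y"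
  shows "comb 0 x y = x" "comb 1 x y = y"
proof -
  have t: "p x \<in> topspace T" using assms by auto
  interpret M: Module.module "scalar_ring K" "V (p x)" using module_fiber t by blast
  have car: "x \<in> carrier (V (p x))" "y \<in> carrier (V (p x))"
    using assms carrier_fiber[OF t] by auto
  have o: "\<one>\<^bsub>scalar_ring K\<^esub> = 1" "\<zero>\<^bsub>scalar_ring K\<^esub> = 0" by (auto simp: scalar_ring_def)
  show "comb 0 x y = x" "comb 1 x y = y"
    using car M.smult_one[of x] M.smult_one[of y] M.smult_l_null[of x] M.smult_l_null[of y]
    by (auto simp: comb_def o)
qed

lemma d_comb_le:
  assumes "x \<in> topspace E" "y \<in> topspace E" "z \<in> topspace E" "p x = p z" "p y = p z" "0 \<le> c" "c \<le> 1"
  shows "d (comb c x y) z \<le> (1 - c) * d x z + c * d y z"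
  using d_comb[OF assms(1,2,3,3,4,5) refl refl assms(6,7)] unfolding comb_same[OF assms(3)] .

lemma N_comb_le:
  assumes "x \<in> topspace E" "y \<in> topspace E" "p x = p y" "0 \<le> c" "c \<le> 1"
  shows "N (comb c x y) \<le> (1 - c) * N x + c * N y"
proof -
  have z: "\<zero>\<^bsub>V (p y)\<^esub> \<in> topspace E" "p \<zero>\<^bsub>V (p y)\<^esub> = p y"
    using zero_in proj_in[OF assms(2)] by blast+
  show ?thesis
    using d_comb_le[OF assms(1,2) z(1) _ _ assms(4,5)] z(2) assms(3)
    unfolding d_zero[OF assms(1,3)] d_zero[OF assms(2) refl] d_zero[OF comb_in[OF assms(1-3)]] by argo
qed

section \<open>The fiber product and neighbourhoods in the bundle space\<close>

definition family :: "('t \<Rightarrow> 'e) \<Rightarrow> bool" where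
  "family f \<longleftrightarrow> (\<forall>t\<in>topspace T. f t \<in> topspace E \<and> p (f t) = t)"

lemma familyD: "family f \<Longrightarrow> t \<in> topspace T \<Longrightarrow> f t \<in> topspace E" "family f \<Longrightarrow> t \<in> topspace T \<Longrightarrow> p (f t) = t"
  by (auto simp: family_def)

definition fiber_product :: "('e \<times> 'e) topology" where
  "fiber_product = subtopology (prod_topology E E) {(x, y). p x = p y}"

lemma fiber_product_iff: "(x, y) \<in> topspace fiber_product \<longleftrightarrow> x \<in> topspace E \<and> y \<in> topspace E \<and> p x = p y"
  by (auto simp: fiber_product_def)

lemma continuous_map_fiber_product_fst: "continuous_map fiber_product E fst"
  and continuous_map_fiber_product_snd: "continuous_map fiber_product E snd"
  unfolding fiber_product_def
  by (auto intro: continuous_map_from_subtopology continuous_map_fst continuous_map_snd)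

text \<open>Turns joint continuity on the fiber product into separate neighbourhoods in
  \<open>E\<close>. Their projections are open in \<open>T\<close> and can be intersected
  there.\<close>

lemma fiber_product_rectangle:
  assumes "openin fiber_product S" "(x, y) \<in> S"
  shows "\<exists>U W. openin E U \<and> openin E W \<and> x \<in> U \<and> y \<in> W \<and>
    (\<forall>x'\<in>U. \<forall>y'\<in>W. p x' = p y' \<longrightarrow> (x', y') \<in> S)"
proof -
  obtain R where R: "openin (prod_topology E E) R" "S = R \<inter> {(x, y). p x = p y}"
    using assms(1) by (auto simp: fiber_product_def openin_subtopology)
  then have "(x, y) \<in> R" using assms(2) by auto
  then obtain U W where "openin E U" "openin E W" "x \<in> U" "y \<in> W" "U \<times> W \<subseteq> R"
    using R(1) unfolding openin_prod_topology_alt by metis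
  then show ?thesis unfolding R(2) by (intro exI[of _ U] exI[of _ W]) auto
qed

lemma continuous_map_scale:
  assumes "continuous_map X (top_of_set K) c" "continuous_map X E f"
  shows "continuous_map X E (\<lambda>z. c z \<odot>\<^bsub>V (p (f z))\<^esub> f z)"
  using continuous_map_compose[OF continuous_map_pairedI[OF assms] scale_continuous]
  by (simp add: o_def)

lemma continuous_map_add_fiber:
  assumes "continuous_map X E f" "continuous_map X E g" "\<And>z. z \<in> topspace X \<Longrightarrow> p (f z) = p (g z)"
  shows "continuous_map X E (\<lambda>z. f z \<oplus>\<^bsub>V (p (f z))\<^esub> g z)"
proof -
  have "continuous_map X (subtopology (prod_topology E E) {(x, y). p x = p y}) (\<lambda>z. (f z, g z))"
    using continuous_map_pairedI[OF assms(1,2)] assms(3) by (auto simp: continuous_map_in_subtopology)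
  from continuous_map_compose[OF this add_continuous] show ?thesis by (simp add: o_def)
qed

lemma smult_in:
  assumes "c \<in> K" "x \<in> topspace E" "p x = t"
  shows "c \<odot>\<^bsub>V t\<^esub> x \<in> topspace E" "p (c \<odot>\<^bsub>V t\<^esub> x) = t"
proof -
  have t: "t \<in> topspace T" using assms by auto
  interpret M: Module.module "scalar_ring K" "V t" using module_fiber t by blast
  have "c \<odot>\<^bsub>V t\<^esub> x \<in> carrier (V t)"
    using assms carrier_fiber[OF t] M.smult_closed[of c x] by (simp add: scalar_ring_def)
  then show "c \<odot>\<^bsub>V t\<^esub> x \<in> topspace E" "p (c \<odot>\<^bsub>V t\<^esub> x) = t"
    using carrier_fiber[OF t] by auto
qed

lemma continuous_map_comb:
  assumes "continuous_map X euclideanreal c" "continuous_map X E f" "continuous_map X E g"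
    "\<And>z. z \<in> topspace X \<Longrightarrow> p (f z) = p (g z)"
  shows "continuous_map X E (\<lambda>z. comb (c z) (f z) (g z))"
proof -
  have c: "continuous_map X (top_of_set K) (\<lambda>z. complex_of_real (u z))" if "continuous_map X euclideanreal u" for u
  proof -
    have c: "continuous_map euclideanreal euclidean complex_of_real"
      by (simp add: continuous_on_of_real)
    have "continuous_map X euclidean (\<lambda>z. complex_of_real (u z))"
      using continuous_map_compose[OF that c] unfolding o_def .
    then show ?thesis by (auto simp: continuous_map_in_subtopology)
  qed
  have cc: "continuous_map X euclideanreal (\<lambda>z. 1 - c z)"
    using assms(1) by (intro continuous_intros)
  have in_E: "f z \<in> topspace E" "g z \<in> topspace E" if "z \<in> topspace X" for z
    using that assms(2,3) by (auto simp: continuous_map_def)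
  have "continuous_map X E (\<lambda>z. (complex_of_real (1 - c z) \<odot>\<^bsub>V (p (f z))\<^esub> f z)
      \<oplus>\<^bsub>V (p (complex_of_real (1 - c z) \<odot>\<^bsub>V (p (f z))\<^esub> f z))\<^esub> (complex_of_real (c z) \<odot>\<^bsub>V (p (g z))\<^esub> g z))"
    by (rule continuous_map_add_fiber continuous_map_scale c cc assms)+
       (use in_E assms(4) smult_in of_real_scalars in \<open>simp del: of_real_diff\<close>)
  then show ?thesis
    by (rule continuous_map_eq) (use in_E assms(4) smult_in of_real_scalars in \<open>simp add: comb_def del: of_real_diff\<close>)
qed

lemma continuous_map_minus_fiber:
  assumes "continuous_map X E f" "continuous_map X E g" "\<And>z. z \<in> topspace X \<Longrightarrow> p (f z) = p (g z)"
  shows "continuous_map X E (\<lambda>z. f z \<ominus>\<^bsub>V (p (f z))\<^esub> g z)"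
proof -
  have in_E: "f z \<in> topspace E" "g z \<in> topspace E" if "z \<in> topspace X" for z
    using that assms(1,2) by (auto simp: continuous_map_def)
  have c: "continuous_map X (top_of_set K) (\<lambda>z. -1)"
    using one_scalars by (auto simp: continuous_map_in_subtopology)
  have "continuous_map X E (\<lambda>z. f z \<oplus>\<^bsub>V (p (f z))\<^esub> ((-1) \<odot>\<^bsub>V (p (g z))\<^esub> g z))"
    by (rule continuous_map_add_fiber continuous_map_scale c assms)+
       (use in_E assms(3) smult_in(2)[OF one_scalars(2)] in simp)
  then show ?thesis
  proof (rule continuous_map_eq)
    fix z assume z: "z \<in> topspace X"
    show "f z \<oplus>\<^bsub>V (p (f z))\<^esub> ((-1) \<odot>\<^bsub>V (p (g z))\<^esub> g z) = f z \<ominus>\<^bsub>V (p (f z))\<^esub> g z"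
      using minus_in(4)[OF in_E[OF z] assms(3)[OF z] refl] assms(3)[OF z] by simp
  qed
qed

text \<open>Upper semi-continuity of the norm, composed with the continuous fiberwise subtraction,
  makes \<open>d\<close> upper semi-continuous.\<close>

lemma openin_d_less:
  assumes "continuous_map X E f" "continuous_map X E g" "\<And>z. z \<in> topspace X \<Longrightarrow> p (f z) = p (g z)"
  shows "openin X {z \<in> topspace X. d (f z) (g z) < a}"
proof -
  have c: "continuous_map X E (\<lambda>z. f z \<ominus>\<^bsub>V (p (f z))\<^esub> g z)"
    by (rule continuous_map_minus_fiber[OF assms])
  have "openin X {z \<in> topspace X. f z \<ominus>\<^bsub>V (p (f z))\<^esub> g z \<in> {x \<in> topspace E. N x < a}}"
    using openin_continuous_map_preimage[OF c open_norm_less] .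
  also have "{z \<in> topspace X. f z \<ominus>\<^bsub>V (p (f z))\<^esub> g z \<in> {x \<in> topspace E. N x < a}}
      = {z \<in> topspace X. d (f z) (g z) < a}"
    using c by (auto simp: d_def continuous_map_def)
  finally show ?thesis .
qed

lemma d_less_near:
  assumes "x \<in> topspace E" "y \<in> topspace E" "p x = p y" "d x y < a"
  shows "\<exists>U W. openin E U \<and> openin E W \<and> x \<in> U \<and> y \<in> W \<and>
    (\<forall>x'\<in>U. \<forall>y'\<in>W. p x' = p y' \<longrightarrow> d x' y' < a)"
proof -
  let ?S = "{z \<in> topspace fiber_product. d (fst z) (snd z) < a}"
  have "openin fiber_product ?S"
    by (rule openin_d_less[OF continuous_map_fiber_product_fst continuous_map_fiber_product_snd])
       (auto simp: fiber_product_def)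
  moreover have "(x, y) \<in> ?S" using assms fiber_product_iff by auto
  ultimately have "\<exists>U W. openin E U \<and> openin E W \<and> x \<in> U \<and> y \<in> W \<and>
    (\<forall>x'\<in>U. \<forall>y'\<in>W. p x' = p y' \<longrightarrow> (x', y') \<in> ?S)"
    by (rule fiber_product_rectangle)
  moreover have "d x' y' < a" if "(x', y') \<in> ?S" for x' y'
    using that by simp
  ultimately show ?thesis by meson
qed

lemma open_proj_image: "openin E U \<Longrightarrow> openin T (p ` U)"
  using proj_open by (simp add: open_map_def)

lemma open_proj_vimage: "openin T W \<Longrightarrow> openin E {x \<in> topspace E. p x \<in> W}"
  using openin_continuous_map_preimage[OF proj_continuous] .

text \<open>The convergence axiom is applied to the coarsest filter on \<open>E\<close> along which
  \<open>p\<close> tends to \<open>t\<close> and \<open>N\<close> to 0. Its basic sets are the tubes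
  over \<open>W\<close> of radius \<open>e\<close>, so convergence of this filter says that every
  neighbourhood of the zero vector contains a tube.\<close>

lemma zero_nbhd:
  assumes t: "t \<in> topspace T" and S: "openin E S" "\<zero>\<^bsub>V t\<^esub> \<in> S"
  shows "\<exists>W e. openin T W \<and> t \<in> W \<and> e > 0 \<and> (\<forall>x\<in>topspace E. p x \<in> W \<longrightarrow> N x < e \<longrightarrow> x \<in> S)"
proof -
  define F where "F = inf (inf (filtercomap p (nhdsin T t)) (filtercomap N (nhds 0))) (principal (topspace E))"
  have "limitin E (\<lambda>x. x) \<zero>\<^bsub>V t\<^esub> F"
  proof (rule null_filter_limit[OF t])
    show "eventually (\<lambda>x. x \<in> topspace E) F"
      unfolding F_def eventually_inf_principal by simp
    show "limitin T p t F"
    proof (unfold limitin_def, intro conjI t allI impI, elim conjE)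
      fix U assume "openin T U" "t \<in> U"
      then have "eventually (\<lambda>x. x \<in> U) (nhdsin T t)"
        using t by (auto simp: eventually_nhdsin)
      then have "eventually (\<lambda>x. p x \<in> U) (filtercomap p (nhdsin T t))"
        by (rule eventually_filtercomapI)
      then show "eventually (\<lambda>x. p x \<in> U) F"
        unfolding F_def by (meson filter_leD inf_le1)
    qed
    have "(N \<longlongrightarrow> 0) (filtercomap N (nhds 0))"
      by (rule filterlim_filtercomap)
    then show "(N \<longlongrightarrow> 0) F"
      unfolding F_def by (meson filterlim_mono inf_le1 inf_le2 order_trans order_refl)
  qed
  then have "eventually (\<lambda>x. x \<in> S) F"
    using S by (auto simp: limitin_def)
  then obtain P Q where P: "eventually P (nhdsin T t)" and Q: "eventually Q (nhds (0::real))"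
    and PQ: "\<And>x. x \<in> topspace E \<Longrightarrow> P (p x) \<Longrightarrow> Q (N x) \<Longrightarrow> x \<in> S"
    unfolding F_def eventually_inf_principal eventually_inf[of _ "filtercomap p _"] eventually_filtercomap
    by (metis (mono_tags, lifting))
  obtain W where W: "openin T W" "t \<in> W" "\<forall>s\<in>W. P s"
    using P t unfolding eventually_nhdsin by auto
  obtain e where e: "e > 0" "\<And>r. dist r 0 < e \<Longrightarrow> Q r"
    using Q unfolding eventually_nhds_metric by auto
  show ?thesis
  proof (intro exI conjI ballI impI)
    show "openin T W" "t \<in> W" "e > 0" by fact+
    fix x assume "x \<in> topspace E" "p x \<in> W" "N x < e"
    then show "x \<in> S" using W(3) e(2)[of "N x"] PQ N_nonneg by (simp add: dist_norm)
  qed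
qed

text \<open>
  Fiberwise thickenings of neighbourhoods of \<open>b\<close> form a neighbourhood base at \<open>b\<close>. This is where
  the convergence axiom of Banach bundles enters.
\<close>

lemma nbhd_thickening:
  assumes S: "openin E S" "b \<in> S"
  shows "\<exists>U e. openin E U \<and> b \<in> U \<and> e > 0 \<and>
    (\<forall>x\<in>topspace E. \<forall>y\<in>U. p x = p y \<longrightarrow> d x y < e \<longrightarrow> x \<in> S)"
proof -
  have b: "b \<in> topspace E" using openin_in[OF S] .
  then have t: "p b \<in> topspace T" by simp
  interpret M: Module.module "scalar_ring K" "V (p b)" using module_fiber t by blast
  \<comment> \<open>A point \<open>x\<close> is rewritten as \<open>y\<close> plus the difference of
    \<open>x\<close> and \<open>y\<close>. Continuity of addition at \<open>b\<close> and the zero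
    vector then reduces the claim to small differences, which lie in a tube.\<close>
  let ?R = "{z \<in> topspace fiber_product. fst z \<oplus>\<^bsub>V (p (fst z))\<^esub> snd z \<in> S}"
  have "continuous_map fiber_product E (\<lambda>z. fst z \<oplus>\<^bsub>V (p (fst z))\<^esub> snd z)"
    by (rule continuous_map_add_fiber[OF continuous_map_fiber_product_fst continuous_map_fiber_product_snd])
       (auto simp: fiber_product_def)
  then have "openin fiber_product ?R"
    using S(1) by (rule openin_continuous_map_preimage)
  moreover have "(b, \<zero>\<^bsub>V (p b)\<^esub>) \<in> ?R"
    using b S(2) zero_in[OF t] carrier_fiber[OF t] by (simp add: fiber_product_iff)
  ultimately obtain U S' where U: "openin E U" "openin E S'" "b \<in> U" "\<zero>\<^bsub>V (p b)\<^esub> \<in> S'"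
    "\<And>x' y'. x' \<in> U \<Longrightarrow> y' \<in> S' \<Longrightarrow> p x' = p y' \<Longrightarrow> (x', y') \<in> ?R"
    using fiber_product_rectangle[of ?R b "\<zero>\<^bsub>V (p b)\<^esub>"] by blast
  obtain W e where W: "openin T W" "p b \<in> W" "e > 0"
    "\<And>x. x \<in> topspace E \<Longrightarrow> p x \<in> W \<Longrightarrow> N x < e \<Longrightarrow> x \<in> S'"
    using zero_nbhd[OF t U(2,4)] by blast
  show ?thesis
  proof (intro exI conjI ballI impI)
    show "openin E (U \<inter> {x \<in> topspace E. p x \<in> W})"
      using U(1) open_proj_vimage[OF W(1)] by blast
    show "b \<in> U \<inter> {x \<in> topspace E. p x \<in> W}" using U(3) W(2) b by auto
    show "e > 0" by fact
    fix x y assume x: "x \<in> topspace E" "y \<in> U \<inter> {x \<in> topspace E. p x \<in> W}" "p x = p y" "d x y < e"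
    then have y: "y \<in> topspace E" "y \<in> U" "p y \<in> W" by auto
    note m = minus_in[OF x(1) y(1) x(3) refl]
    have "N (x \<ominus>\<^bsub>V (p y)\<^esub> y) < e" using x(3,4) by (simp add: d_def)
    then have "x \<ominus>\<^bsub>V (p y)\<^esub> y \<in> S'" using W(4) m y by simp
    then show "x \<in> S" using U(5)[OF y(2)] m by force
  qed
qed

section \<open>Families that are continuous up to an error\<close>

text \<open>
  A set-theoretic family \<open>f\<close> is continuous at \<open>t\<close> up to an error \<open>e\<close>. The open set \<open>U\<close> is not
  required to contain \<open>f t\<close>: this makes the notion stable under convex combinations.
\<close>

definition econt :: "real \<Rightarrow> ('t \<Rightarrow> 'e) \<Rightarrow> 't \<Rightarrow> bool" where
  "econt e f t \<longleftrightarrow> (\<forall>e'>e. \<exists>U. openin E U \<and> t \<in> p ` U \<and> (\<forall>y\<in>U. d (f (p y)) y < e'))"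

lemma econtE:
  assumes "econt e f t" "e' > e"
  shows "\<exists>U y. openin E U \<and> y \<in> U \<and> p y = t \<and> (\<forall>y\<in>U. d (f (p y)) y < e')"
  using assms unfolding econt_def by blast

text \<open>The tube of radius \<open>e' - r\<close> around the zero section serves as the open set:
  by the triangle inequality its points are closer than \<open>e'\<close> to values of norm at most
  \<open>r\<close>.\<close>

lemma econt_small:
  assumes "family f" "openin T W" "t \<in> W" "\<And>s. s \<in> W \<Longrightarrow> N (f s) \<le> r"
  shows "econt r f t"
  unfolding econt_def
proof (intro allI impI)
  fix e' assume e': "r < e'"
  have t: "t \<in> topspace T" using openin_in[OF assms(2,3)] .
  let ?U = "{x \<in> topspace E. p x \<in> W} \<inter> {x \<in> topspace E. N x < e' - r}"
  have "openin E ?U" using open_proj_vimage[OF assms(2)] open_norm_less by blast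
  moreover have "t \<in> p ` ?U"
    using zero_in[OF t] N_zero[OF t] assms(3) e' by (auto intro!: image_eqI[of _ _ "\<zero>\<^bsub>V t\<^esub>"])
  moreover have "d (f (p y)) y < e'" if "y \<in> ?U" for y
  proof -
    have "d (f (p y)) y \<le> N (f (p y)) + N y"
      using that familyD[OF assms(1)] by (intro d_le) auto
    then show ?thesis using that assms(4)[of "p y"] by auto
  qed
  ultimately show "\<exists>U. openin E U \<and> t \<in> p ` U \<and> (\<forall>y\<in>U. d (f (p y)) y < e')" by blast
qed

lemma econt_cong:
  assumes "econt e f t" "openin T W" "t \<in> W" "\<And>s. s \<in> W \<Longrightarrow> f' s = f s"
  shows "econt e f' t"
  unfolding econt_def
proof (intro allI impI)
  fix e' assume e': "e < e'"
  obtain U y where U: "openin E U" "y \<in> U" "p y = t" "\<And>y. y \<in> U \<Longrightarrow> d (f (p y)) y < e'"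
    using econtE[OF assms(1) e'] by blast
  let ?U = "U \<inter> {x \<in> topspace E. p x \<in> W}"
  have "openin E ?U" using open_proj_vimage[OF assms(2)] U(1) by blast
  moreover have "t \<in> p ` ?U" using U(2,3) assms(3) openin_in[OF U(1,2)] by auto
  moreover have "\<forall>y\<in>?U. d (f' (p y)) y < e'" using U(4) assms(4) by simp
  ultimately show "\<exists>U. openin E U \<and> t \<in> p ` U \<and> (\<forall>y\<in>U. d (f' (p y)) y < e')" by blast
qed

text \<open>The witnesses \<open>x\<close> for \<open>f\<close> and \<open>y\<close> for
  \<open>g\<close> are combined into a point \<open>b\<close> over \<open>t\<close>. Near
  \<open>b\<close> only those points \<open>z\<close> are kept whose fiber meets both shrunken
  witness sets; there some \<open>x'\<close> and \<open>y'\<close> have a combination close to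
  \<open>z\<close>, while \<open>d_comb\<close> bounds its distance to the combined family by the
  larger of the two errors.\<close>

lemma econt_comb:
  assumes fam: "family f" "family g" and c: "continuous_map T euclideanreal c"
    and c01: "\<And>s. s \<in> topspace T \<Longrightarrow> 0 \<le> c s \<and> c s \<le> 1"
    and "econt e f t" "econt e g t"
  shows "econt e (\<lambda>s. comb (c s) (f s) (g s)) t"
  unfolding econt_def
proof (intro allI impI)
  fix e' assume e': "e < e'"
  \<comment> \<open>The errors of \<open>f\<close> and \<open>g\<close> are kept below
    \<open>e''\<close>; the rest \<open>e' - e''\<close> pays for the distance from the combination
    of \<open>x'\<close> and \<open>y'\<close> to \<open>z\<close>.\<close>
  define e'' where "e'' = (e + e') / 2"
  have e'': "e < e''" "0 < e' - e''" using e' by (auto simp: e''_def field_simps)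
  obtain U x where U: "openin E U" "x \<in> U" "p x = t" "\<And>y. y \<in> U \<Longrightarrow> d (f (p y)) y < e''"
    using econtE[OF assms(5) e''(1)] by blast
  obtain W y where W: "openin E W" "y \<in> W" "p y = t" "\<And>y. y \<in> W \<Longrightarrow> d (g (p y)) y < e''"
    using econtE[OF assms(6) e''(1)] by blast
  have xy: "x \<in> topspace E" "y \<in> topspace E" "p x = p y"
    using openin_in[OF U(1,2)] openin_in[OF W(1,2)] U(3) W(3) by simp_all
  define b where "b = comb (c t) x y"
  have b: "b \<in> topspace E" "p b = t" using comb_in[OF xy] W by (auto simp: b_def)
  obtain Q R where QR: "openin E Q" "openin E R" "b \<in> Q" "b \<in> R"
    "\<And>x' y'. x' \<in> Q \<Longrightarrow> y' \<in> R \<Longrightarrow> p x' = p y' \<Longrightarrow> d x' y' < e' - e''"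
    using d_less_near[OF b(1) b(1) refl, of "e' - e''"] e''(2) d_same[OF b(1)] by auto
  \<comment> \<open>The weight depends on the base point, so continuity is used jointly in the
    weight and in both points.\<close>
  let ?h = "\<lambda>z. comb (c (p (fst z))) (fst z) (snd z)"
  have "continuous_map fiber_product euclideanreal (\<lambda>z. c (p (fst z)))"
    using continuous_map_compose[OF continuous_map_compose[OF continuous_map_fiber_product_fst proj_continuous] c]
    by (simp add: o_def)
  then have "continuous_map fiber_product E ?h"
    by (rule continuous_map_comb[OF _ continuous_map_fiber_product_fst continuous_map_fiber_product_snd])
       (auto simp: fiber_product_def)
  then have "openin fiber_product {z \<in> topspace fiber_product. ?h z \<in> Q}"
    using QR(1) by (rule openin_continuous_map_preimage)
  moreover have "(x, y) \<in> {z \<in> topspace fiber_product. ?h z \<in> Q}"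
    using xy QR(3) by (simp add: fiber_product_iff b_def U(3) flip: xy(3))
  ultimately obtain U' W' where UW: "openin E U'" "openin E W'" "x \<in> U'" "y \<in> W'"
    "\<And>x' y'. x' \<in> U' \<Longrightarrow> y' \<in> W' \<Longrightarrow> p x' = p y' \<Longrightarrow> (x', y') \<in> {z \<in> topspace fiber_product. ?h z \<in> Q}"
    using fiber_product_rectangle[of "{z \<in> topspace fiber_product. ?h z \<in> Q}" x y] by blast
  let ?A = "R \<inter> {z \<in> topspace E. p z \<in> p ` (U \<inter> U')} \<inter> {z \<in> topspace E. p z \<in> p ` (W \<inter> W')}"
  have "openin E ?A"
    using QR(2) open_proj_vimage open_proj_image U(1) W(1) UW(1,2) by (meson openin_Int)
  moreover have "t \<in> p ` ?A"
  proof
    show "t = p b" using b by simp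
    have "t \<in> p ` (U \<inter> U')" "t \<in> p ` (W \<inter> W')"
      using image_eqI[of t p x "U \<inter> U'"] image_eqI[of t p y "W \<inter> W'"] U(2,3) W(2,3) UW(3,4) by simp_all
    then show "b \<in> ?A" using b QR(4) by simp
  qed
  moreover have "d (comb (c (p z)) (f (p z)) (g (p z))) z < e'" if z: "z \<in> ?A" for z
  proof -
    have zA: "z \<in> R" "p z \<in> p ` (U \<inter> U')" "p z \<in> p ` (W \<inter> W')" and zE: "z \<in> topspace E" "p z \<in> topspace T"
      using z by simp_all
    obtain x' where x': "x' \<in> U" "x' \<in> U'" "p x' = p z"
      using zA(2) unfolding image_iff by (metis IntE)
    obtain y' where y': "y' \<in> W" "y' \<in> W'" "p y' = p z"
      using zA(3) unfolding image_iff by (metis IntE)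
    have in_E: "x' \<in> topspace E" "y' \<in> topspace E" using openin_in[OF U(1) x'(1)] openin_in[OF W(1) y'(1)] by simp_all
    note fz = familyD[OF fam(1) zE(2)] familyD[OF fam(2) zE(2)]
    have pe: "p x' = p y'" using x'(3) y'(3) by simp
    have "d (comb (c (p z)) x' y') z < e' - e''"
      using QR(5)[of "comb (c (p z)) x' y'" z] UW(5)[OF x'(2) y'(2) pe] zA(1) comb_in(2)[OF in_E pe] x'(3) y'(3)
      by simp
    moreover have "d (comb (c (p z)) (f (p z)) (g (p z))) (comb (c (p z)) x' y')
        \<le> (1 - c (p z)) * d (f (p z)) x' + c (p z) * d (g (p z)) y'"
      using d_comb[OF fz(1,3) in_E fz(2,4) x'(3) y'(3)] c01[OF zE(2)] by simp
    moreover have "\<dots> < e''"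
      using U(4)[OF x'(1)] W(4)[OF y'(1)] c01[OF zE(2)] x'(3) y'(3) by (intro convex_less) simp_all
    moreover have "d (comb (c (p z)) (f (p z)) (g (p z))) z
       \<le> d (comb (c (p z)) (f (p z)) (g (p z))) (comb (c (p z)) x' y') + d (comb (c (p z)) x' y') z"
      by (rule d_triangle) (use comb_in[OF in_E pe] comb_in[OF fz(1,3)] fz(2,4) y'(3) zE in simp_all)
    ultimately show ?thesis by linarith
  qed
  ultimately show "\<exists>U. openin E U \<and> t \<in> p ` U \<and> (\<forall>y\<in>U. d (comb (c (p y)) (f (p y)) (g (p y))) y < e')"
    by (intro exI[of _ ?A] conjI ballI)
qed

text \<open>The witness set for the approximant \<open>h\<close> may lie away from
  \<open>f t\<close>, so \<open>f s\<close> is compared with a point \<open>x\<close> near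
  \<open>f t\<close> through \<open>h s\<close> and a point \<open>z\<close> of the witness set over
  \<open>s\<close>. Closeness of \<open>x\<close> and \<open>z\<close> is inherited from
  \<open>f t\<close> and \<open>y\<close>, and \<open>nbhd_thickening\<close> turns the resulting
  estimate into membership in \<open>S\<close>.\<close>

lemma econt_uniform_limit:
  assumes fam: "family f"
    and approx: "\<And>e. e > 0 \<Longrightarrow> \<exists>h. family h \<and> (\<forall>t\<in>topspace T. econt e h t \<and> d (h t) (f t) \<le> e)"
  shows "continuous_map T E f"
  unfolding continuous_map_atin limitin_atin
proof (intro ballI conjI allI impI)
  fix t assume t: "t \<in> topspace T"
  show ft: "f t \<in> topspace E" using familyD[OF fam t] by simp
  fix S assume S: "openin E S \<and> f t \<in> S"
  obtain U e where U: "openin E U" "f t \<in> U" "e > 0"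
    "\<And>x y. x \<in> topspace E \<Longrightarrow> y \<in> U \<Longrightarrow> p x = p y \<Longrightarrow> d x y < e \<Longrightarrow> x \<in> S"
    using nbhd_thickening[of S "f t"] S by blast
  \<comment> \<open>The chain from \<open>f s\<close> to \<open>x\<close> costs at most
    \<open>r\<close> for \<open>f s\<close> to \<open>h s\<close>, \<open>2 * r\<close> on to
    \<open>z\<close> and \<open>3 * r\<close> on to \<open>x\<close>, in all \<open>6 * r\<close>,
    which is below \<open>e\<close>.\<close>
  define r where "r = e / 8"
  have r: "r > 0" "8 * r = e" using U(3) by (auto simp: r_def)
  obtain h where h: "family h" "\<And>t. t \<in> topspace T \<Longrightarrow> econt r h t" "\<And>t. t \<in> topspace T \<Longrightarrow> d (h t) (f t) \<le> r"
    using approx[OF r(1)] by blast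
  have r2: "r < 2 * r" using r by simp
  obtain R y where R: "openin E R" "y \<in> R" "p y = t" "\<And>y. y \<in> R \<Longrightarrow> d (h (p y)) y < 2 * r"
    using econtE[OF h(2)[OF t] r2] by blast
  have y: "y \<in> topspace E" using openin_in[OF R(1,2)] .
  note ht = familyD[OF h(1)] and ff = familyD[OF fam]
  have "d (f t) y \<le> d (f t) (h t) + d (h t) y"
    by (rule d_triangle) (use ht[OF t] ff[OF t] y R(3) in simp_all)
  also have "\<dots> < 3 * r" using h(3)[OF t] R(4)[OF R(2)] d_commute[of "f t" "h t"] ht[OF t] ff[OF t] R(3) by simp
  finally have "d (f t) y < 3 * r" .
  then obtain U' R' where UR: "openin E U'" "openin E R'" "f t \<in> U'" "y \<in> R'"
    "\<And>x' y'. x' \<in> U' \<Longrightarrow> y' \<in> R' \<Longrightarrow> p x' = p y' \<Longrightarrow> d x' y' < 3 * r"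
    using d_less_near[of "f t" y "3 * r"] ff[OF t] y R(3) by auto
  let ?W = "p ` (U \<inter> U') \<inter> p ` (R \<inter> R')"
  have "f s \<in> S" if s: "s \<in> ?W" for s
  proof -
    have s': "s \<in> p ` (U \<inter> U')" "s \<in> p ` (R \<inter> R')" using s by simp_all
    obtain x where x: "x \<in> U" "x \<in> U'" "p x = s"
      using s'(1) unfolding image_iff by (metis IntE)
    obtain z where z: "z \<in> R" "z \<in> R'" "p z = s"
      using s'(2) unfolding image_iff by (metis IntE)
    have E: "x \<in> topspace E" "z \<in> topspace E" using openin_in U(1) R(1) x(1) z(1) by metis+
    then have s: "s \<in> topspace T" using x by auto
    have "d (f s) x \<le> d (f s) (h s) + d (h s) x"
      by (rule d_triangle) (use ht[OF s] ff[OF s] x(3) E in simp_all)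
    also have "d (f s) (h s) \<le> r" using h(3)[OF s] d_commute[of "f s" "h s"] ht[OF s] ff[OF s] by simp
    also have "d (h s) x \<le> d (h s) z + d z x"
      by (rule d_triangle) (use ht[OF s] ff[OF s] x(3) z(3) E in simp_all)
    also have "d z x = d x z" using d_commute[OF E] x(3) z(3) by simp
    also have "d (h s) z < 2 * r" using R(4)[OF z(1)] z by simp
    also have "d x z < 3 * r" using UR(5) x z by simp
    finally have "d (f s) x < e" using r by linarith
    then show ?thesis using U(4)[OF ff(1)[OF s] x(1)] ff(2)[OF s] x(3) by simp
  qed
  moreover have "openin T ?W"
    using U(1) R(1) UR(1,2) open_proj_image by (meson openin_Int)
  moreover have "t \<in> ?W"
    using U(2) UR(3,4) R(2,3) ff(2)[OF t] by (metis IntI image_eqI)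
  ultimately show "\<exists>W. openin T W \<and> t \<in> W \<and> f ` (W - {t}) \<subseteq> S" by blast
qed

text \<open>In place of a partition of unity, the members of a finite subcover are treated one after
  another, each local family overriding the previous global one through its bump function. Every
  intermediate value is a convex combination of two elements of \<open>S t\<close>, so the
  constraint survives.\<close>

lemma econt_glue:
  assumes T: "completely_regular_space T" and C: "compactin T C"
    and S_in: "\<And>t x. t \<in> topspace T \<Longrightarrow> x \<in> S t \<Longrightarrow> x \<in> topspace E \<and> p x = t"
    and S_convex: "\<And>t x y c. t \<in> topspace T \<Longrightarrow> x \<in> S t \<Longrightarrow> y \<in> S t \<Longrightarrow> 0 \<le> c \<Longrightarrow> c \<le> 1 \<Longrightarrow> comb c x y \<in> S t"
    and f: "\<And>t. t \<in> topspace T \<Longrightarrow> f t \<in> S t"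
    and local_sel: "\<And>t. t \<in> C \<Longrightarrow> \<exists>W h. openin T W \<and> t \<in> W \<and> (\<forall>s\<in>W. h s \<in> S s \<and> econt e h s)"
  shows "\<exists>F. (\<forall>t\<in>topspace T. F t \<in> S t) \<and> (\<forall>t\<in>C. econt e F t)"
proof -
  have CT: "C \<subseteq> topspace T" using C compactin_subset_topspace by blast
  have "\<exists>W h \<psi> A D. (openin T W \<and> (\<forall>s\<in>W. h s \<in> S s \<and> econt e h s)) \<and> t \<in> A \<and> bump_data T W \<psi> A D"
    if t: "t \<in> C" for t
  proof -
    obtain W h where W: "openin T W" "t \<in> W" "\<forall>s\<in>W. h s \<in> S s \<and> econt e h s"
      using local_sel[OF t] by blast
    obtain \<psi> A D where "t \<in> A" "bump_data T W \<psi> A D"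
      using bump_data_exists[OF T W(1,2)] by blast
    with W show ?thesis by blast
  qed
  then obtain W h \<psi> A D where
    data: "\<And>t. t \<in> C \<Longrightarrow> openin T (W t)" "\<And>t s. t \<in> C \<Longrightarrow> s \<in> W t \<Longrightarrow> h t s \<in> S s \<and> econt e (h t) s"
      "\<And>t. t \<in> C \<Longrightarrow> t \<in> A t" "\<And>t. t \<in> C \<Longrightarrow> bump_data T (W t) (\<psi> t) (A t) (D t)"
    by metis
  have fam: "family F" if "\<And>t. t \<in> topspace T \<Longrightarrow> F t \<in> S t" for F
    using S_in that by (simp add: family_def)
  have *: "\<exists>F. (\<forall>t\<in>topspace T. F t \<in> S t) \<and> (\<forall>t\<in>(\<Union>i\<in>I. A i). econt e F t)"
    if "finite I" "I \<subseteq> C" for I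
    using that
  proof (induction I)
    case empty
    then show ?case using f by auto
  next
    case (insert i I)
    from insert.prems have "I \<subseteq> C" by simp
    from insert.IH[OF this] obtain F where F: "\<forall>t\<in>topspace T. F t \<in> S t" "\<forall>t\<in>(\<Union>i\<in>I. A i). econt e F t"
      by (elim exE conjE)
    note F = bspec[OF F(1)] bspec[OF F(2)]
    have i: "i \<in> C" using insert by auto
    note b = data(4)[OF i, unfolded bump_data_def]
    \<comment> \<open>The fallback to \<open>F\<close> makes \<open>H\<close> a family in
      \<open>S\<close> over the whole base. Its jump at the edge of \<open>W i\<close> does no harm,
      since \<psi> vanishes off a closed subset of \<open>W i\<close>.\<close>
    define H where "H s = (if s \<in> W i then h i s else F s)" for s
    define G where "G s = comb (\<psi> i s) (F s) (H s)" for s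
    have H: "H s \<in> S s" if "s \<in> topspace T" for s
      using F(1)[OF that] data(2)[OF i] by (simp add: H_def)
    have FH: "F s \<in> topspace E" "H s \<in> topspace E" "p (F s) = s" "p (H s) = s" if "s \<in> topspace T" for s
      using S_in[OF that F(1)[OF that]] S_in[OF that H[OF that]] by auto
    have G: "G s \<in> S s" if "s \<in> topspace T" for s
      unfolding G_def using S_convex[OF that F(1)[OF that] H[OF that]] b that by simp
    have H_cont: "econt e H s" if "s \<in> W i" for s
      by (rule econt_cong[OF _ data(1)[OF i] that, of _ "h i"]) (use data(2)[OF i that] in \<open>auto simp: H_def\<close>)
    \<comment> \<open>On \<open>A i\<close> the new family is \<open>H\<close>; at other points of
      \<open>W i\<close> both \<open>F\<close> and \<open>H\<close> are good and
      \<open>econt_comb\<close> applies; outside \<open>W i\<close> the new family is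
      \<open>F\<close> near \<open>t\<close>.\<close>
    have "econt e G t" if t: "t \<in> (\<Union>j\<in>insert i I. A j)" for t
    proof (cases "t \<in> A i")
      case True
      have AT: "s \<in> topspace T" if "s \<in> A i" for s using b that openin_in by metis
      show ?thesis
      proof (rule econt_cong[OF _ _ True])
        show "econt e H t" using H_cont b True by blast
        show "openin T (A i)" using b by blast
        show "G s = H s" if "s \<in> A i" for s
          using b that comb_0_1(2)[of "F s" "H s"] FH[OF AT[OF that]] by (simp add: G_def)
      qed
    next
      case False
      then obtain j where j: "j \<in> I" "t \<in> A j" using t by auto
      then have "j \<in> C" using insert.prems by auto
      then have tT: "t \<in> topspace T" using data(4)[of j] j(2) openin_in unfolding bump_data_def by metis
      have Ft: "econt e F t" using F(2) j by auto
      show ?thesis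
      proof (cases "t \<in> W i")
        case True
        have "econt e (\<lambda>s. comb (\<psi> i s) (F s) (H s)) t"
          by (rule econt_comb) (use fam[of F] fam[of H] F(1) H b Ft H_cont[OF True] in auto)
        then show ?thesis unfolding G_def[abs_def] .
      next
        case no: False
        show ?thesis
        proof (rule econt_cong[OF Ft])
          show "openin T (topspace T - D i)" using b by blast
          show "t \<in> topspace T - D i" using tT no b by blast
          show "G s = F s" if s: "s \<in> topspace T - D i" for s
            using b s comb_0_1(1)[of "F s" "H s"] FH[of s] by (simp add: G_def)
        qed
      qed
    qed
    then show ?case using G by (intro exI[of _ G]) blast
  qed
  obtain \<F> where F: "finite \<F>" "\<F> \<subseteq> A ` C" "C \<subseteq> \<Union>\<F>"
  proof -
    have 1: "\<And>U. U \<in> A ` C \<Longrightarrow> openin T U" using data(4) unfolding bump_data_def by blast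
    have 2: "C \<subseteq> \<Union>(A ` C)" using data(3) by blast
    show thesis using compactinD[OF C 1 2] that by blast
  qed
  then obtain I where I: "finite I" "I \<subseteq> C" "\<F> = A ` I" by (meson finite_subset_image)
  obtain G where G: "\<forall>t\<in>topspace T. G t \<in> S t" "\<forall>t\<in>(\<Union>i\<in>I. A i). econt e G t"
    using *[OF I(1,2)] by blast
  have "\<forall>t\<in>C. econt e G t" using G(2) F(3) unfolding I(3) by blast
  then show ?thesis using G(1) by blast
qed

text \<open>Within one fiber \<open>d\<close> is a genuine metric, so a Cauchy rate passes to the
  limit. The rate \<open>b\<close> is explicit because the same one, used in all fibers, later makes
  the convergence uniform.\<close>

lemma fiber_complete:
  assumes t: "t \<in> topspace T" and u: "\<And>n. u n \<in> topspace E" "\<And>n. p (u n) = t"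
    and b: "\<And>m n. n \<le> m \<Longrightarrow> d (u m) (u n) \<le> b n" "b \<longlonglongrightarrow> (0::real)"
  shows "\<exists>x\<in>topspace E. p x = t \<and> (\<forall>n. d (u n) x \<le> b n)"
proof -
  interpret M: Metric_space "{x \<in> topspace E. p x = t}" "norm_dist (V t) N"
    by (rule metric_fiber[OF t])
  have complete: M.mcomplete
    using banach_fiber[OF t] unfolding banach_space_over_def carrier_fiber[OF t] by blast
  have nd: "norm_dist (V t) N (u m) (u n) = d (u m) (u n)" for m n
    by (rule norm_dist_eq) (simp_all add: u)
  have nd': "norm_dist (V t) N (u m) x = d (u m) x" if "x \<in> topspace E" "p x = t" for m x
    by (rule norm_dist_eq) (simp_all add: u that)
  have "M.MCauchy u"
    unfolding M.MCauchy_def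
  proof (intro conjI allI impI)
    show "range u \<subseteq> {x \<in> topspace E. p x = t}" using u by auto
    fix e :: real assume "e > 0"
    then obtain n0 where n0: "\<And>n. n \<ge> n0 \<Longrightarrow> b n < e"
      using order_tendstoD(2)[OF b(2)] unfolding eventually_sequentially by blast
    have "norm_dist (V t) N (u m) (u n) < e" if "m \<ge> n0" "n \<ge> n0" for m n
    proof (cases "n \<le> m")
      case True
      then show ?thesis using b(1)[of n m] n0[of n] that nd by force
    next
      case False
      then have "d (u n) (u m) \<le> b m" using b(1)[of m n] by simp
      then show ?thesis using n0[of m] that nd[of n m] M.commute[of "u m" "u n"] by simp
    qed
    then show "\<exists>n0. \<forall>n n'. n0 \<le> n \<longrightarrow> n0 \<le> n' \<longrightarrow> norm_dist (V t) N (u n) (u n') < e" by blast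
  qed
  then obtain x where x: "limitin M.mtopology u x sequentially"
    using complete unfolding M.mcomplete_def by blast
  then have xE: "x \<in> topspace E" "p x = t" using M.limitin_mspace by blast+
  have lim: "(\<lambda>n. d (u n) x) \<longlonglongrightarrow> 0"
    using x unfolding M.limitin_metric_dist_null nd'[OF xE] by blast
  have "d (u n) x \<le> b n" for n
  proof (rule tendsto_lowerbound)
    have "(\<lambda>m. b n + d (u m) x) \<longlonglongrightarrow> b n + 0" by (intro tendsto_intros lim)
    then show "(\<lambda>m. b n + d (u m) x) \<longlonglongrightarrow> b n" by simp
    show "\<forall>\<^sub>F m in sequentially. d (u n) x \<le> b n + d (u m) x"
      unfolding eventually_sequentially
    proof (intro exI allI impI)
      fix m assume "n \<le> m"
      then have "d (u n) (u m) \<le> b n" using b(1) d_commute[of "u n" "u m"] u by simp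
      moreover have "d (u n) x \<le> d (u n) (u m) + d (u m) x"
        by (rule d_triangle) (simp_all add: u xE)
      ultimately show "d (u n) x \<le> b n + d (u m) x" by simp
    qed
  qed simp
  then show ?thesis using xE by blast
qed

end

section \<open>Surjective bundle maps and correction within a fiber\<close>

locale surjective_bundle_map =
  X: bundled_banach_spaces K \<xi>1 + Y: bundled_banach_spaces K \<xi>2
  for K :: "complex set" and \<xi>1 :: "('t, 'e1) bundle_data" and \<xi>2 :: "('t, 'e2) bundle_data" +
  fixes \<phi> :: "'e1 \<Rightarrow> 'e2" and m B :: real
  assumes base: "Y.T = X.T"
    and norm_continuous: "continuous_map Y.E euclideanreal Y.N"
    and bundle_map: "banach_bundle_map K \<xi>1 \<xi>2 \<phi>"
    and m_pos: "m > 0"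
    and lift: "y \<in> topspace Y.E \<Longrightarrow> \<exists>x\<in>topspace X.E. \<phi> x = y \<and> X.N x \<le> m * Y.N y"
    and B_pos: "B > 0"
    and bound: "x \<in> topspace X.E \<Longrightarrow> Y.N (\<phi> x) \<le> B * X.N x"
begin

lemma map_continuous: "continuous_map X.E Y.E \<phi>"
  using bundle_map by (simp add: banach_bundle_map_def)

lemma map_in:
  assumes "x \<in> topspace X.E" "X.p x = t"
  shows "\<phi> x \<in> topspace Y.E" "Y.p (\<phi> x) = t"
proof -
  have t: "t \<in> topspace X.T" "t \<in> topspace Y.T" using assms X.proj_in base by auto
  have "\<phi> ` carrier (X.V t) \<subseteq> carrier (Y.V t)"
    using bundle_map t unfolding banach_bundle_map_def by blast
  then show "\<phi> x \<in> topspace Y.E" "Y.p (\<phi> x) = t"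
    using assms unfolding X.carrier_fiber[OF t(1)] Y.carrier_fiber[OF t(2)] by auto
qed

lemma map_add:
  assumes "x \<in> topspace X.E" "y \<in> topspace X.E" "X.p x = t" "X.p y = t"
  shows "\<phi> (x \<oplus>\<^bsub>X.V t\<^esub> y) = \<phi> x \<oplus>\<^bsub>Y.V t\<^esub> \<phi> y"
proof -
  have t: "t \<in> topspace X.T" using assms X.proj_in by auto
  have "x \<in> carrier (X.V t)" "y \<in> carrier (X.V t)" using assms X.carrier_fiber[OF t] by auto
  then show ?thesis using bundle_map t unfolding banach_bundle_map_def by blast
qed

lemma map_smult:
  assumes "x \<in> topspace X.E" "X.p x = t" "c \<in> K"
  shows "\<phi> (c \<odot>\<^bsub>X.V t\<^esub> x) = c \<odot>\<^bsub>Y.V t\<^esub> \<phi> x"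
proof -
  have t: "t \<in> topspace X.T" using assms X.proj_in by auto
  have "x \<in> carrier (X.V t)" using assms X.carrier_fiber[OF t] by auto
  then show ?thesis using bundle_map t assms(3) unfolding banach_bundle_map_def by blast
qed

lemma map_comb:
  assumes "x \<in> topspace X.E" "y \<in> topspace X.E" "X.p x = t" "X.p y = t"
  shows "\<phi> (X.comb c x y) = Y.comb c (\<phi> x) (\<phi> y)"
proof -
  have K: "complex_of_real (1 - c) \<in> K" "complex_of_real c \<in> K"
    by (simp_all del: of_real_diff)
  note sx = X.smult_in[OF K(1) assms(1,3)] and sy = X.smult_in[OF K(2) assms(2,4)]
  show ?thesis
    unfolding X.comb_def Y.comb_def assms(3) map_in(2)[OF assms(1,3)]
      map_add[OF sx(1) sy(1) sx(2) sy(2)] map_smult[OF assms(1,3) K(1)] map_smult[OF assms(2,4) K(2)] ..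
qed

lemma map_d:
  assumes "x \<in> topspace X.E" "y \<in> topspace X.E" "X.p x = t" "X.p y = t"
  shows "Y.d (\<phi> x) (\<phi> y) \<le> B * X.d x y"
proof -
  note sy = X.smult_in[OF X.one_scalars(2) assms(2,4)]
  note px = map_in[OF assms(1,3)] and py = map_in[OF assms(2,4)]
  have "\<phi> (x \<ominus>\<^bsub>X.V t\<^esub> y) = \<phi> x \<ominus>\<^bsub>Y.V t\<^esub> \<phi> y"
    unfolding X.minus_in(4)[OF assms] Y.minus_in(4)[OF px(1) py(1) px(2) py(2)]
      map_add[OF assms(1) sy(1) assms(3) sy(2)] map_smult[OF assms(2,4) X.one_scalars(2)] ..
  then show ?thesis
    using bound[OF X.minus_in(1)[OF assms]] unfolding X.d_def Y.d_def assms(3) px(2) by simp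
qed

lemma lift_fiber:
  assumes "y \<in> topspace Y.E" "Y.p y = t"
  shows "\<exists>x\<in>topspace X.E. X.p x = t \<and> \<phi> x = y \<and> X.N x \<le> m * Y.N y"
  using lift[OF assms(1)] map_in(2)[OF _ refl] assms(2) by metis

text \<open>The lifting hypothesis is applied to the error of \<open>\<phi> x\<close> against
  \<open>y\<close> rather than to \<open>y\<close>; by additivity, adding the lift to
  \<open>x\<close> gives an exact preimage.\<close>

lemma correct_fiber:
  assumes x: "x \<in> topspace X.E" "X.p x = t" and y: "y \<in> topspace Y.E" "Y.p y = t"
  shows "\<exists>c\<in>topspace X.E. X.p c = t \<and> \<phi> c = y \<and> X.d c x \<le> m * Y.d y (\<phi> x)"
proof -
  have t: "t \<in> topspace X.T" using X.proj_in x by blast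
  note px = map_in[OF x]
  note dy = Y.minus_in[OF y(1) px(1) y(2) px(2)]
  obtain z where z: "z \<in> topspace X.E" "X.p z = t" "\<phi> z = y \<ominus>\<^bsub>Y.V t\<^esub> \<phi> x"
    "X.N z \<le> m * Y.N (y \<ominus>\<^bsub>Y.V t\<^esub> \<phi> x)"
    using lift_fiber[OF dy(1,2)] by blast
  let ?c = "x \<oplus>\<^bsub>X.V t\<^esub> z"
  interpret M: Module.module "scalar_ring K" "X.V t" using X.module_fiber t by blast
  have car: "x \<in> carrier (X.V t)" "z \<in> carrier (X.V t)" using x z X.carrier_fiber[OF t] by auto
  have "?c \<in> carrier (X.V t)" using car by simp
  then have c: "?c \<in> topspace X.E" "X.p ?c = t" using X.carrier_fiber[OF t] by auto
  have "?c \<ominus>\<^bsub>X.V t\<^esub> x = z"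
    using car by (simp add: a_minus_def M.M.a_comm[of x z] M.M.a_assoc M.M.r_neg)
  then have "X.d ?c x \<le> m * Y.d y (\<phi> x)"
    using z(4) c(2) y(2) by (simp add: X.d_def Y.d_def)
  moreover have "\<phi> ?c = y"
    using map_add[OF x(1) z(1) x(2) z(2)] dy(3) z(3) by simp
  ultimately show ?thesis using c by blast
qed

lemma map_sections:
  assumes "f \<in> Gamma0 \<xi>1"
  shows "induced_map \<xi>1 \<phi> f \<in> Gamma0 \<xi>2"
proof -
  let ?g = "induced_map \<xi>1 \<phi> f"
  have f: "continuous_map X.T X.E f" "\<And>t. t \<in> topspace X.T \<Longrightarrow> X.p (f t) = t"
    "\<And>e. e > 0 \<Longrightarrow> compactin X.T {t \<in> topspace X.T. e \<le> X.N (f t)}"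
    using assms by (auto simp: Gamma0_def bundle_sections_def)
  have fE: "f t \<in> topspace X.E" if "t \<in> topspace X.T" for t
    using f(1) that by (auto simp: continuous_map_def)
  have g_eq: "?g t = \<phi> (f t)" if "t \<in> topspace X.T" for t
    using that by (simp add: induced_map_def)
  have g: "continuous_map X.T Y.E ?g"
    by (rule continuous_map_eq[OF continuous_map_compose[OF f(1) map_continuous]]) (simp add: g_eq)
  have "compactin X.T {t \<in> topspace X.T. e \<le> Y.N (?g t)}" if e: "e > 0" for e
  proof (rule closed_compactin)
    show "compactin X.T {t \<in> topspace X.T. e / B \<le> X.N (f t)}" using f(3) e B_pos by simp
    show "{t \<in> topspace X.T. e \<le> Y.N (?g t)} \<subseteq> {t \<in> topspace X.T. e / B \<le> X.N (f t)}"
    proof clarify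
      fix t assume t: "t \<in> topspace X.T" "e \<le> Y.N (?g t)"
      then have "e \<le> B * X.N (f t)" using bound[OF fE[OF t(1)]] g_eq[OF t(1)] by simp
      then show "e / B \<le> X.N (f t)" using B_pos by (simp add: field_simps)
    qed
    have "closedin X.T {t \<in> topspace X.T. (Y.N \<circ> ?g) t \<in> {e..}}"
      by (rule closedin_continuous_map_preimage[OF continuous_map_compose[OF g norm_continuous]]) simp
    then show "closedin X.T {t \<in> topspace X.T. e \<le> Y.N (?g t)}" by simp
  qed
  moreover have "Y.p (?g t) = t" if "t \<in> topspace X.T" for t
    using map_in(2)[OF fE[OF that] f(2)[OF that]] g_eq[OF that] by simp
  ultimately show ?thesis
    using g by (simp add: Gamma0_def bundle_sections_def base induced_map_def)
qed

section \<open>Norm-controlled preimages and the halving of the defect\<close>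

text \<open>
  The slack between \<open>m\<close> and \<open>m + 1\<close> and the strict inequality keep the norm bound valid under the
  small local corrections, without a constant that changes from step to step.
\<close>

definition sel :: "('t \<Rightarrow> 'e2) \<Rightarrow> 't \<Rightarrow> 'e1 set" where
  "sel g t = {x \<in> topspace X.E. X.p x = t \<and> \<phi> x = g t \<and> X.N x \<le> (m + 1) * Y.N (g t) \<and>
     (Y.N (g t) \<noteq> 0 \<longrightarrow> X.N x < (m + 1) * Y.N (g t))}"

context
  fixes g :: "'t \<Rightarrow> 'e2"
  assumes g_cont: "continuous_map X.T Y.E g"
    and g_sec: "t \<in> topspace X.T \<Longrightarrow> Y.p (g t) = t"
begin

lemma g_in: "t \<in> topspace X.T \<Longrightarrow> g t \<in> topspace Y.E"
  using g_cont by (auto simp: continuous_map_def)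

lemma N_g_continuous: "continuous_map X.T euclideanreal (\<lambda>t. Y.N (g t))"
  using continuous_map_compose[OF g_cont norm_continuous] by (simp add: o_def)

lemma sel_comb:
  assumes t: "t \<in> topspace X.T" and x: "x \<in> sel g t" "y \<in> sel g t" and c: "0 \<le> c" "c \<le> 1"
  shows "X.comb c x y \<in> sel g t"
proof -
  have xy: "x \<in> topspace X.E" "X.p x = t" "\<phi> x = g t" "y \<in> topspace X.E" "X.p y = t" "\<phi> y = g t"
    using x by (auto simp: sel_def)
  have pe: "X.p x = X.p y" using xy by simp
  have N: "X.N (X.comb c x y) \<le> (1 - c) * X.N x + c * X.N y"
    by (rule X.N_comb_le[OF xy(1,4) pe c])
  have le: "(1 - c) * X.N x + c * X.N y \<le> (m + 1) * Y.N (g t)"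
    using convex_bound_le[of "X.N x" "(m + 1) * Y.N (g t)" "X.N y" "1 - c" c] x c by (simp add: sel_def)
  have less: "(1 - c) * X.N x + c * X.N y < (m + 1) * Y.N (g t)" if "Y.N (g t) \<noteq> 0"
    by (rule convex_less[OF c]) (use x that in \<open>auto simp: sel_def\<close>)
  have "\<phi> (X.comb c x y) = g t"
    using map_comb[OF xy(1,4,2,5), of c] xy(3,6) Y.comb_same[OF g_in[OF t]] by simp
  then show ?thesis
    using X.comb_in[OF xy(1,4) pe, of c] xy(5) N le less unfolding sel_def by fastforce
qed

lemma sel_nonempty:
  assumes "t \<in> topspace X.T"
  shows "\<exists>x. x \<in> sel g t"
proof -
  obtain x where x: "x \<in> topspace X.E" "X.p x = t" "\<phi> x = g t" "X.N x \<le> m * Y.N (g t)"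
    using lift_fiber[OF g_in[OF assms] g_sec[OF assms]] by blast
  have "Y.N (g t) \<ge> 0" using Y.N_nonneg g_in assms by blast
  then have "x \<in> sel g t" using x by (auto simp: sel_def algebra_simps)
  then show ?thesis by blast
qed

text \<open>The distance from \<open>g (X.p x)\<close> to \<open>\<phi> x\<close> is upper
  semi-continuous in \<open>x\<close> and 0 at \<open>b\<close>, so it stays below
  \<open>r / m\<close> near \<open>b\<close>; \<open>correct_fiber\<close> multiplies it by
  \<open>m\<close>.\<close>

lemma correct_near:
  assumes t: "t \<in> topspace X.T" and b: "b \<in> topspace X.E" "X.p b = t" "\<phi> b = g t" and r: "r > 0"
  shows "\<exists>U. openin X.E U \<and> b \<in> U \<and>
    (\<forall>x\<in>U. \<exists>c\<in>topspace X.E. X.p c = X.p x \<and> \<phi> c = g (X.p x) \<and> X.d c x < r)"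
proof (intro exI conjI ballI)
  let ?U = "{x \<in> topspace X.E. Y.d (g (X.p x)) (\<phi> x) < r / m}"
  have "continuous_map X.E Y.E (\<lambda>x. g (X.p x))"
    using continuous_map_compose[OF X.proj_continuous g_cont] by (simp add: o_def)
  then show "openin X.E ?U"
    by (rule Y.openin_d_less[OF _ map_continuous]) (simp add: map_in(2)[OF _ refl] g_sec)
  show "b \<in> ?U" using b r m_pos g_in[OF t] by simp
  fix x assume x: "x \<in> ?U"
  then have xE: "x \<in> topspace X.E" "X.p x \<in> topspace X.T" by auto
  obtain c where c: "c \<in> topspace X.E" "X.p c = X.p x" "\<phi> c = g (X.p x)"
    "X.d c x \<le> m * Y.d (g (X.p x)) (\<phi> x)"
    using correct_fiber[OF xE(1) refl g_in[OF xE(2)] g_sec[OF xE(2)]] by blast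
  have "m * Y.d (g (X.p x)) (\<phi> x) < r" using x m_pos by (simp add: field_simps)
  then show "\<exists>c\<in>topspace X.E. X.p c = X.p x \<and> \<phi> c = g (X.p x) \<and> X.d c x < r"
    using c by force
qed

text \<open>The new family takes exact preimages close to points of a small neighbourhood
  \<open>U\<close> of \<open>f t\<close>, so its defect is governed by the size of \<open>U\<close>.
  Where \<open>g t\<close> has nonzero norm, the strict inequality in \<open>sel\<close> leaves room
  for this perturbation.\<close>

lemma local_refinement:
  assumes t: "t \<in> topspace X.T" and f: "\<And>s. s \<in> topspace X.T \<Longrightarrow> f s \<in> sel g s"
    and cont: "X.econt e f t" and e: "e > 0" and pos: "Y.N (g t) \<noteq> 0"
  shows "\<exists>W h. openin X.T W \<and> t \<in> W \<and>
    (\<forall>s\<in>W. (h s \<in> sel g s \<and> X.d (h s) (f s) \<le> 3 * e) \<and> X.econt (e / 2) h s)"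
proof -
  define b where "b = f t"
  have b: "b \<in> topspace X.E" "X.p b = t" "\<phi> b = g t" "X.N b < (m + 1) * Y.N (g t)"
    using f[OF t] pos by (auto simp: sel_def b_def)
  define gap where "gap = (m + 1) * Y.N (g t) - X.N b"
  have gap: "gap > 0" using b by (simp add: gap_def)
  \<comment> \<open>A value of \<open>h\<close> is within \<open>r\<close> of some point of
    \<open>U\<close>, and that point within \<open>r\<close> of any other in its fiber: together at
    most \<open>e / 2\<close>. For the norm, \<open>X.N (h s)\<close> stays below
    \<open>X.N b + gap / 2\<close>, while the allowed bound at \<open>s\<close> stays above
    \<open>X.N b + 3 / 4 * gap\<close>.\<close>
  define r where "r = min (e / 4) (gap / 4)"
  have r: "r > 0" "r \<le> e / 4" "r \<le> gap / 4" using e gap by (auto simp: r_def)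
  obtain U1 where U1: "openin X.E U1" "b \<in> U1"
    "\<And>x. x \<in> U1 \<Longrightarrow> \<exists>c\<in>topspace X.E. X.p c = X.p x \<and> \<phi> c = g (X.p x) \<and> X.d c x < r"
    using correct_near[OF t b(1-3) r(1)] by blast
  have "X.d b b < r" using b r by simp
  from X.d_less_near[OF b(1) b(1) refl this] obtain Q R where
    Q: "openin X.E Q" "b \<in> Q" and R: "openin X.E R" "b \<in> R"
    and QR: "\<And>x y. x \<in> Q \<Longrightarrow> y \<in> R \<Longrightarrow> X.p x = X.p y \<Longrightarrow> X.d x y < r"
    by blast
  \<comment> \<open>Any factor above 1 provides a witness; it is spent twice, and with
    \<open>r\<close> the movement is at most 11/4 of \<open>e\<close>, hence below
    \<open>3 * e\<close>.\<close>
  have e54: "e < 5 / 4 * e" using e by simp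
  obtain A y where A: "openin X.E A" "y \<in> A" "X.p y = t" "\<And>y. y \<in> A \<Longrightarrow> X.d (f (X.p y)) y < 5 / 4 * e"
    using X.econtE[OF cont e54] by blast
  have y: "y \<in> topspace X.E" by (rule openin_in[OF A(1,2)])
  have "X.d b y < 5 / 4 * e" using A(4)[OF A(2)] A(3) by (simp add: b_def)
  moreover have "X.p b = X.p y" using b A by simp
  ultimately obtain Q' R' where Q': "openin X.E Q'" "b \<in> Q'" and R': "openin X.E R'" "y \<in> R'"
    and QR': "\<And>x z. x \<in> Q' \<Longrightarrow> z \<in> R' \<Longrightarrow> X.p x = X.p z \<Longrightarrow> X.d x z < 5 / 4 * e"
    using X.d_less_near[OF b(1) y] by metis
  \<comment> \<open>Lower semi-continuity of the norm along \<open>g\<close>: the margin is divided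
    by \<open>m + 1\<close> so that the allowed bound drops by less than
    \<open>gap / 4\<close>.\<close>
  define C where "C = {s \<in> topspace X.T. Y.N (g s) \<in> {Y.N (g t) - gap / (4 * (m + 1))<..}}"
  have C: "openin X.T C" unfolding C_def
    by (rule openin_continuous_map_preimage[OF N_g_continuous]) simp
  \<comment> \<open>Over \<open>W0\<close> each fiber contains a point \<open>z\<close> that is
    close to \<open>f s\<close>, being in \<open>A\<close>, and close to the points of
    \<open>Q'\<close>, being in \<open>R'\<close>.\<close>
  define W0 where "W0 = X.p ` (A \<inter> R') \<inter> C"
  have W0: "openin X.T W0"
    unfolding W0_def using C X.open_proj_image A(1) R'(1) by blast
  have tW0: "t \<in> W0"
    using A(2,3) R'(2) t gap m_pos image_eqI[of t X.p y "A \<inter> R'"] by (simp add: W0_def C_def)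
  define U where "U = U1 \<inter> Q \<inter> R \<inter> Q' \<inter> {x \<in> topspace X.E. X.N x < X.N b + gap / 4}
    \<inter> {x \<in> topspace X.E. X.p x \<in> W0}"
  have U: "openin X.E U" unfolding U_def
    by (intro openin_Int U1(1) Q(1) R(1) Q'(1) X.open_norm_less X.open_proj_vimage W0)
  have bU: "b \<in> U" using U1 Q R Q' b gap tW0 by (simp add: U_def)
  have "\<forall>s\<in>X.p ` U. \<exists>c. \<exists>x\<in>U. X.p x = s \<and> c \<in> topspace X.E \<and> X.p c = s \<and> \<phi> c = g s \<and> X.d c x < r"
  proof
    fix s assume "s \<in> X.p ` U"
    then obtain x where x: "x \<in> U" "X.p x = s" by (metis imageE)
    have "x \<in> U1" using x(1) by (simp add: U_def)
    from U1(3)[OF this] x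
    show "\<exists>c. \<exists>x\<in>U. X.p x = s \<and> c \<in> topspace X.E \<and> X.p c = s \<and> \<phi> c = g s \<and> X.d c x < r"
      by metis
  qed
  from bchoice[OF this] obtain h where
    h: "\<And>s. s \<in> X.p ` U \<Longrightarrow> \<exists>x\<in>U. X.p x = s \<and> h s \<in> topspace X.E \<and> X.p (h s) = s \<and> \<phi> (h s) = g s \<and> X.d (h s) x < r"
    by blast
  show ?thesis
  proof (intro exI conjI ballI)
    show "openin X.T (X.p ` U)" by (rule X.open_proj_image[OF U])
    show "t \<in> X.p ` U" using bU b(2) image_eqI[of t X.p b U] by simp
    fix s assume s: "s \<in> X.p ` U"
    obtain x where x: "x \<in> U" "X.p x = s" and hs: "h s \<in> topspace X.E" "X.p (h s) = s" "\<phi> (h s) = g s" "X.d (h s) x < r"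
      using h[OF s] by metis
    have xU: "x \<in> Q" "x \<in> Q'" "X.N x < X.N b + gap / 4" "s \<in> W0" "x \<in> topspace X.E"
      using x by (auto simp: U_def)
    then have sT: "s \<in> topspace X.T" using W0 openin_in by metis
    have sC: "Y.N (g s) > Y.N (g t) - gap / (4 * (m + 1))" using xU(4) by (simp add: W0_def C_def)
    have "(m + 1) * Y.N (g t) - gap / 4 = (m + 1) * (Y.N (g t) - gap / (4 * (m + 1)))"
      using m_pos by (simp add: field_simps)
    also have "\<dots> < (m + 1) * Y.N (g s)" using sC m_pos by (intro mult_strict_left_mono) auto
    finally have N_gs: "(m + 1) * Y.N (g t) - gap / 4 < (m + 1) * Y.N (g s)" .
    have "X.N (h s) \<le> X.d (h s) x + X.N x"
      by (rule X.N_le) (simp_all add: hs x xU)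
    then have "X.N (h s) < (m + 1) * Y.N (g s)"
      using hs(4) xU(3) r(3) N_gs gap unfolding gap_def by argo
    then show "h s \<in> sel g s" using hs by (simp add: sel_def)
    have "s \<in> X.p ` (A \<inter> R')" using xU(4) by (simp add: W0_def)
    then obtain z where z: "z \<in> A" "z \<in> R'" "X.p z = s" by (metis IntE imageE)
    have zE: "z \<in> topspace X.E" by (rule openin_in[OF A(1) z(1)])
    have fs: "f s \<in> topspace X.E" "X.p (f s) = s" using f[OF sT] by (auto simp: sel_def)
    have "X.d (h s) (f s) \<le> X.d (h s) x + X.d x (f s)"
      by (rule X.d_triangle) (simp_all add: hs x xU fs)
    moreover have "X.d x (f s) \<le> X.d x z + X.d z (f s)"
      by (rule X.d_triangle) (simp_all add: x xU fs z zE)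
    moreover have "X.d z (f s) = X.d (f s) z"
      by (rule X.d_commute) (simp_all add: fs z zE)
    moreover have "X.d (f s) z < 5 / 4 * e" using A(4)[OF z(1)] z(3) by simp
    moreover have "X.d x z < 5 / 4 * e" using QR'[OF xU(2) z(2)] x(2) z(3) by simp
    ultimately show "X.d (h s) (f s) \<le> 3 * e" using hs(4) r(2) e by linarith
    have "X.d (h (X.p z)) z < e / 2" if z: "z \<in> U" for z
    proof -
      have "X.p z \<in> X.p ` U" using z by blast
      from h[OF this] obtain x where x: "x \<in> U" "X.p x = X.p z" and
        hz: "h (X.p z) \<in> topspace X.E" "X.p (h (X.p z)) = X.p z" "X.d (h (X.p z)) x < r"
        by metis
      have xz: "x \<in> topspace X.E" "z \<in> topspace X.E" "x \<in> Q" "z \<in> R" using x(1) z by (auto simp: U_def)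
      have "X.d (h (X.p z)) z \<le> X.d (h (X.p z)) x + X.d x z"
        by (rule X.d_triangle) (simp_all add: hz x xz)
      moreover have "X.d x z < r" by (rule QR[OF xz(3,4) x(2)])
      ultimately show ?thesis using hz(3) r(2) by linarith
    qed
    then show "X.econt (e / 2) h s"
      unfolding X.econt_def using U s by (meson less_trans)
  qed
qed

lemma refinement:
  assumes T: "completely_regular_space X.T"
    and g0: "\<And>e. e > 0 \<Longrightarrow> compactin X.T {t \<in> topspace X.T. e \<le> Y.N (g t)}"
    and f: "\<And>t. t \<in> topspace X.T \<Longrightarrow> f t \<in> sel g t"
    and cont: "\<And>t. t \<in> topspace X.T \<Longrightarrow> X.econt e f t" and e: "e > 0"
  shows "\<exists>f'. (\<forall>t\<in>topspace X.T. f' t \<in> sel g t \<and> X.econt (e / 2) f' t \<and> X.d (f' t) (f t) \<le> 3 * e)"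
proof -
  \<comment> \<open>Where the norm of \<open>g\<close> is below \<open>c\<close>, every element of
    \<open>sel g t\<close> has norm at most \<open>e / 2\<close>, so \<open>econt_small\<close>
    already gives the halved defect. Where it is at least \<open>c\<close>, it is nonzero, as
    \<open>local_refinement\<close> requires.\<close>
  define c where "c = e / 2 / (m + 1)"
  have c: "c > 0" "(m + 1) * c = e / 2" using e m_pos by (simp_all add: c_def field_simps add_pos_pos)
  let ?C = "{t \<in> topspace X.T. c \<le> Y.N (g t)}"
  \<comment> \<open>The bound on the movement becomes part of the convex constraint, so gluing
    preserves it.\<close>
  let ?S = "\<lambda>t. {x \<in> sel g t. X.d x (f t) \<le> 3 * e}"
  have fE: "f t \<in> topspace X.E" "X.p (f t) = t" if "t \<in> topspace X.T" for t
    using f[OF that] by (auto simp: sel_def)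
  have "\<exists>F. (\<forall>t\<in>topspace X.T. F t \<in> ?S t) \<and> (\<forall>t\<in>?C. X.econt (e / 2) F t)"
  proof (rule X.econt_glue[OF T g0[OF c(1)]])
    show "x \<in> topspace X.E \<and> X.p x = t" if "t \<in> topspace X.T" "x \<in> ?S t" for t x
      using that by (simp add: sel_def)
    show "X.comb a x y \<in> ?S t"
      if t: "t \<in> topspace X.T" and x: "x \<in> ?S t" and y: "y \<in> ?S t" and a: "0 \<le> a" "a \<le> 1" for t x y a
    proof -
      have xy: "x \<in> topspace X.E" "X.p x = t" "y \<in> topspace X.E" "X.p y = t" using x y by (auto simp: sel_def)
      have "X.d (X.comb a x y) (f t) \<le> (1 - a) * X.d x (f t) + a * X.d y (f t)"
        by (rule X.d_comb_le) (simp_all add: xy a fE[OF t])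
      also have "\<dots> \<le> 3 * e"
        using convex_bound_le[of "X.d x (f t)" "3 * e" "X.d y (f t)" "1 - a" a] x y a by simp
      finally show ?thesis using sel_comb[OF t _ _ a, of x y] x y by simp
    qed
    show "f t \<in> ?S t" if "t \<in> topspace X.T" for t using f[OF that] fE[OF that] e by simp
    show "\<exists>W h. openin X.T W \<and> t \<in> W \<and> (\<forall>s\<in>W. h s \<in> ?S s \<and> X.econt (e / 2) h s)" if t: "t \<in> ?C" for t
      using local_refinement[OF _ f cont e, of t] t c(1) by auto
  qed
  then obtain F where F: "\<And>t. t \<in> topspace X.T \<Longrightarrow> F t \<in> ?S t" "\<And>t. t \<in> ?C \<Longrightarrow> X.econt (e / 2) F t"
    by blast
  have "X.econt (e / 2) F t" if t: "t \<in> topspace X.T" for t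
  proof (cases "t \<in> ?C")
    case True
    then show ?thesis by (rule F(2))
  next
    case False
    show ?thesis
    proof (rule X.econt_small)
      show "X.family F" using F(1) by (simp add: X.family_def sel_def)
      show "openin X.T {s \<in> topspace X.T. Y.N (g s) \<in> {..<c}}"
        by (rule openin_continuous_map_preimage[OF N_g_continuous]) simp
      show "t \<in> {s \<in> topspace X.T. Y.N (g s) \<in> {..<c}}" using False t by auto
      fix s assume "s \<in> {s \<in> topspace X.T. Y.N (g s) \<in> {..<c}}"
      then have s: "s \<in> topspace X.T" "Y.N (g s) < c" by auto
      then have "X.N (F s) \<le> (m + 1) * Y.N (g s)" using F(1) by (simp add: sel_def)
      also have "\<dots> \<le> (m + 1) * c" using s(2) m_pos by (intro mult_left_mono) auto
      finally show "X.N (F s) \<le> e / 2" using c by simp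
    qed
  qed
  then show ?thesis using F(1) by blast
qed

section \<open>The uniform limit of the refined families\<close>

lemma N_g_bounded:
  assumes "compactin X.T {t \<in> topspace X.T. 1 \<le> Y.N (g t)}"
  shows "\<exists>b>0. \<forall>t\<in>topspace X.T. Y.N (g t) \<le> b"
proof -
  have "compactin euclideanreal ((\<lambda>t. Y.N (g t)) ` {t \<in> topspace X.T. 1 \<le> Y.N (g t)})"
    by (rule image_compactin[OF assms N_g_continuous])
  then have "bounded ((\<lambda>t. Y.N (g t)) ` {t \<in> topspace X.T. 1 \<le> Y.N (g t)})"
    by (simp add: compact_imp_bounded)
  then obtain b where b: "\<And>t. t \<in> topspace X.T \<Longrightarrow> 1 \<le> Y.N (g t) \<Longrightarrow> \<bar>Y.N (g t)\<bar> \<le> b"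
    unfolding bounded_iff by auto
  have "Y.N (g t) \<le> max 1 b" if "t \<in> topspace X.T" for t
    using b[OF that] by linarith
  then show ?thesis by (intro exI[of _ "max 1 b"]) auto
qed

lemma lift_section:
  assumes T: "completely_regular_space X.T"
    and g0: "\<And>e. e > 0 \<Longrightarrow> compactin X.T {t \<in> topspace X.T. e \<le> Y.N (g t)}"
  shows "\<exists>f\<in>Gamma0 \<xi>1. \<forall>t\<in>topspace X.T. \<phi> (f t) = g t"
proof -
  obtain b where b: "b > 0" "\<And>t. t \<in> topspace X.T \<Longrightarrow> Y.N (g t) \<le> b"
    using N_g_bounded[OF g0] by auto
  \<comment> \<open>\<open>e 0\<close> bounds the norm of every element of \<open>sel g t\<close>,
    so an arbitrary first selection has this defect by \<open>econt_small\<close>.\<close>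
  define e where "e n = (m + 1) * b / 2 ^ n" for n :: nat
  have e: "e n > 0" "e (Suc n) = e n / 2" for n using b m_pos by (simp_all add: e_def)
  let ?P = "\<lambda>n f. \<forall>t\<in>topspace X.T. f t \<in> sel g t \<and> X.econt (e n) f t"
  let ?Q = "\<lambda>n f f'. \<forall>t\<in>topspace X.T. X.d (f' t) (f t) \<le> 3 * e n"
  have "\<exists>F. \<forall>n. ?P n (F n) \<and> ?Q n (F n) (F (Suc n))"
  proof (rule dependent_nat_choice)
    obtain f where f: "\<And>t. t \<in> topspace X.T \<Longrightarrow> f t \<in> sel g t"
      using sel_nonempty by metis
    have "X.econt (e 0) f t" if t: "t \<in> topspace X.T" for t
    proof (rule X.econt_small[OF _ _ t])
      show "X.family f" using f by (simp add: X.family_def sel_def)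
      fix s assume s: "s \<in> topspace X.T"
      have "X.N (f s) \<le> (m + 1) * Y.N (g s)" using f[OF s] by (simp add: sel_def)
      also have "\<dots> \<le> e 0" using b(2)[OF s] m_pos by (simp add: e_def)
      finally show "X.N (f s) \<le> e 0" .
    qed simp
    then show "\<exists>f. ?P 0 f" using f by blast
  next
    fix f n assume f: "?P n f"
    show "\<exists>f'. ?P (Suc n) f' \<and> ?Q n f f'"
      unfolding e(2) using refinement[OF T g0 _ _ e(1)[of n], of f] f by blast
  qed
  then obtain F where F: "\<And>n t. t \<in> topspace X.T \<Longrightarrow> F n t \<in> sel g t"
    "\<And>n t. t \<in> topspace X.T \<Longrightarrow> X.econt (e n) (F n) t"
    "\<And>n t. t \<in> topspace X.T \<Longrightarrow> X.d (F (Suc n) t) (F n t) \<le> 3 * e n"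
    by blast
  have FE: "F n t \<in> topspace X.E" "X.p (F n t) = t" "\<phi> (F n t) = g t" "X.N (F n t) \<le> (m + 1) * Y.N (g t)"
    if "t \<in> topspace X.T" for n t
    using F(1)[OF that, of n] by (simp_all add: sel_def)
  have e_lim: "e \<longlonglongrightarrow> 0"
    unfolding e_def by real_asymp
  \<comment> \<open>The movements telescope exactly, because
    \<open>3 * e n = 6 * e n - 6 * e (Suc n)\<close>.\<close>
  have step: "X.d (F (n + k) t) (F n t) \<le> 6 * e n - 6 * e (n + k)" if t: "t \<in> topspace X.T" for n k t
  proof (induction k)
    case 0
    then show ?case using FE[OF t] by simp
  next
    case (Suc k)
    have "X.d (F (n + Suc k) t) (F n t) \<le> X.d (F (n + Suc k) t) (F (n + k) t) + X.d (F (n + k) t) (F n t)"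
      by (rule X.d_triangle) (simp_all add: FE[OF t])
    then show ?case using Suc F(3)[OF t, of "n + k"] e(2)[of "n + k"] by simp
  qed
  have Cauchy: "X.d (F k t) (F n t) \<le> 6 * e n" if t: "t \<in> topspace X.T" and "n \<le> k" for n k t
    using step[OF t, of n "k - n"] \<open>n \<le> k\<close> e(1)[of k] by simp
  have "\<exists>x\<in>topspace X.E. X.p x = t \<and> (\<forall>n. X.d (F n t) x \<le> 6 * e n)" if t: "t \<in> topspace X.T" for t
  proof (rule X.fiber_complete[OF t])
    have "(\<lambda>n. 6 * e n) \<longlonglongrightarrow> 6 * 0" by (intro tendsto_intros e_lim)
    then show "(\<lambda>n. 6 * e n) \<longlonglongrightarrow> 0" by simp
  qed (use FE[OF t] Cauchy[OF t] in auto)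
  then obtain f where f: "\<And>t. t \<in> topspace X.T \<Longrightarrow> f t \<in> topspace X.E" "\<And>t. t \<in> topspace X.T \<Longrightarrow> X.p (f t) = t"
    "\<And>t n. t \<in> topspace X.T \<Longrightarrow> X.d (F n t) (f t) \<le> 6 * e n"
    by metis
  have small: "\<exists>n. e n \<le> r \<and> 6 * e n \<le> r" if "r > 0" for r
  proof -
    have "eventually (\<lambda>n. e n < r / 6) sequentially"
      by (rule order_tendstoD(2)[OF e_lim]) (use that in simp)
    then obtain n where "e n < r / 6" unfolding eventually_sequentially by blast
    then show ?thesis using e(1)[of n] by (intro exI[of _ n]) auto
  qed
  have f_cont: "continuous_map X.T X.E f"
  proof (rule X.econt_uniform_limit)
    show "X.family f" using f by (simp add: X.family_def)
    fix r :: real assume "r > 0"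
    then obtain n where n: "e n \<le> r" "6 * e n \<le> r" using small by blast
    have "X.econt r (F n) t" if "t \<in> topspace X.T" for t
      using F(2)[OF that, of n] n(1) unfolding X.econt_def by (meson le_less_trans)
    moreover have "X.d (F n t) (f t) \<le> r" if "t \<in> topspace X.T" for t
      using f(3)[OF that, of n] n(2) by linarith
    ultimately show "\<exists>h. X.family h \<and> (\<forall>t\<in>topspace X.T. X.econt r h t \<and> X.d (h t) (f t) \<le> r)"
      using FE by (intro exI[of _ "F n"]) (auto simp: X.family_def)
  qed
  \<comment> \<open>On fibers \<phi> is Lipschitz with constant \<open>B\<close>, so the identity
    valid for every \<open>F n\<close> passes to the limit; \<open>d\<close> separates the points of
    a fiber.\<close>
  have \<phi>f: "\<phi> (f t) = g t" if t: "t \<in> topspace X.T" for t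
  proof -
    note pf = map_in[OF f(1,2)[OF t]]
    have le: "Y.d (g t) (\<phi> (f t)) \<le> r" if r: "r > 0" for r
    proof -
      obtain n where n: "6 * e n \<le> r / B" using small[of "r / B"] r B_pos by auto
      have "Y.d (g t) (\<phi> (f t)) \<le> B * X.d (F n t) (f t)"
        using map_d[OF FE(1)[OF t] f(1)[OF t] FE(2)[OF t] f(2)[OF t], of n] FE(3)[OF t] by simp
      also have "\<dots> \<le> B * (r / B)" using f(3)[OF t, of n] n B_pos by (intro mult_left_mono) auto
      also have "\<dots> = r" using B_pos by simp
      finally show ?thesis .
    qed
    have "Y.d (g t) (\<phi> (f t)) \<le> 0"
    proof (rule field_le_epsilon)
      fix r :: real assume "0 < r"
      from le[OF this] show "Y.d (g t) (\<phi> (f t)) \<le> 0 + r" by simp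
    qed
    moreover have pe: "Y.p (g t) = Y.p (\<phi> (f t))" using g_sec[OF t] pf by simp
    ultimately have "Y.d (g t) (\<phi> (f t)) = 0" using Y.d_nonneg[OF g_in[OF t] pf(1) pe] by simp
    then show ?thesis using Y.d_eq_0[OF g_in[OF t] pf(1) pe] by simp
  qed
  \<comment> \<open>The strict inequality in \<open>sel\<close> may be lost in the limit; the weak
    one survives and is enough for vanishing at infinity.\<close>
  have N_f: "X.N (f t) \<le> (m + 1) * Y.N (g t)" if t: "t \<in> topspace X.T" for t
  proof (rule field_le_epsilon)
    fix r :: real assume "r > 0"
    then obtain n where n: "6 * e n \<le> r" using small by blast
    have "X.N (f t) \<le> X.d (f t) (F n t) + X.N (F n t)"
      by (rule X.N_le) (simp_all add: FE[OF t] f[OF t])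
    moreover have "X.d (f t) (F n t) = X.d (F n t) (f t)"
      by (rule X.d_commute) (simp_all add: FE[OF t] f[OF t])
    ultimately show "X.N (f t) \<le> (m + 1) * Y.N (g t) + r"
      using FE(4)[OF t, of n] f(3)[OF t, of n] n by linarith
  qed
  have compact: "compactin X.T {t \<in> topspace X.T. r \<le> X.N (f t)}" if r: "r > 0" for r
  proof (rule closed_compactin)
    show "compactin X.T {t \<in> topspace X.T. r / (m + 1) \<le> Y.N (g t)}" using g0 r m_pos by simp
    show "{t \<in> topspace X.T. r \<le> X.N (f t)} \<subseteq> {t \<in> topspace X.T. r / (m + 1) \<le> Y.N (g t)}"
    proof clarify
      fix t assume t: "t \<in> topspace X.T" "r \<le> X.N (f t)"
      then have "r \<le> (m + 1) * Y.N (g t)" using N_f[OF t(1)] by simp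
      then show "r / (m + 1) \<le> Y.N (g t)" using m_pos by (simp add: field_simps)
    qed
    have "openin X.T {t \<in> topspace X.T. f t \<in> {x \<in> topspace X.E. X.N x < r}}"
      by (rule openin_continuous_map_preimage[OF f_cont X.open_norm_less])
    moreover have "topspace X.T - {t \<in> topspace X.T. r \<le> X.N (f t)}
        = {t \<in> topspace X.T. f t \<in> {x \<in> topspace X.E. X.N x < r}}"
      using f(1) by auto
    ultimately show "closedin X.T {t \<in> topspace X.T. r \<le> X.N (f t)}"
      unfolding closedin_def by simp
  qed
  \<comment> \<open>\<open>Gamma0\<close> consists of functions that are \<open>undefined\<close>
    off the base, while \<open>f\<close> came from a choice with arbitrary values there.\<close>
  define f' where "f' = restrict f (topspace X.T)"
  have f': "f' t = f t" if "t \<in> topspace X.T" for t using that by (simp add: f'_def)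
  have "continuous_map X.T X.E f'"
    by (rule continuous_map_eq[OF f_cont]) (simp add: f')
  moreover have "{t \<in> topspace X.T. r \<le> X.N (f' t)} = {t \<in> topspace X.T. r \<le> X.N (f t)}" for r
    using f' by auto
  moreover have "f' \<in> extensional (topspace X.T)" by (simp add: f'_def)
  ultimately have "f' \<in> Gamma0 \<xi>1"
    using f(2) f' compact by (simp add: Gamma0_def bundle_sections_def)
  then show ?thesis using \<phi>f f' by (intro bexI[of _ f']) simp_all
qed

end

end

section \<open>From the supremum of the fiber norms to a uniform bound, and the theorem\<close>

lemma fiber_onorm_bound:
  assumes "banach_bundle K \<xi>1" and K: "K = \<real> \<or> K = UNIV" and "banach_bundle K \<xi>2" and "base_space \<xi>2 = base_space \<xi>1"
    and map: "banach_bundle_map K \<xi>1 \<xi>2 \<phi>"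
    and sup: "(SUP t \<in> topspace (base_space \<xi>1). fiber_onorm \<xi>1 \<xi>2 \<phi> t) < \<infinity>"
  shows "\<exists>B>0. \<forall>x\<in>topspace (bundle_space \<xi>1). fnorm \<xi>2 (\<phi> x) \<le> B * fnorm \<xi>1 x"
proof -
  interpret X: bundled_banach_spaces K \<xi>1 using assms by unfold_locales
  interpret Y: bundled_banach_spaces K \<xi>2 using assms by unfold_locales
  define S where "S = (SUP t \<in> topspace X.T. fiber_onorm \<xi>1 \<xi>2 \<phi> t)"
  \<comment> \<open>The summand 1 keeps \<open>B\<close> positive even when all fiber norms are 0;
    divisions by \<open>B\<close> occur later.\<close>
  define B where "B = enn2real S + 1"
  have S: "S < \<infinity>" using sup by (simp add: S_def)
  have B: "B > 0" by (simp add: B_def add_nonneg_pos)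
  have unit: "Y.N (\<phi> x) \<le> B" if x: "x \<in> topspace X.E" "X.N x \<le> 1" for x
  proof -
    have t: "X.p x \<in> topspace X.T" using x by simp
    have "ennreal (Y.N (\<phi> x)) \<le> fiber_onorm \<xi>1 \<xi>2 \<phi> (X.p x)"
      unfolding fiber_onorm_def X.carrier_fiber[OF t] using x by (intro SUP_upper) auto
    also have "\<dots> \<le> S" unfolding S_def using t by (intro SUP_upper)
    finally have "ennreal (Y.N (\<phi> x)) \<le> ennreal (enn2real S)" using S by (simp add: top.not_eq_extremum)
    then have "Y.N (\<phi> x) \<le> enn2real S" by (simp add: ennreal_le_iff)
    then show ?thesis by (simp add: B_def)
  qed
  have "Y.N (\<phi> x) \<le> B * X.N x" if x: "x \<in> topspace X.E" for x
  proof -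
    let ?t = "X.p x"
    have t: "?t \<in> topspace X.T" "?t \<in> topspace Y.T" using x assms(4) by simp_all
    have xc: "x \<in> carrier (X.V ?t)" using x X.carrier_fiber[OF t(1)] by simp
    have "\<phi> ` carrier (X.V ?t) \<subseteq> carrier (Y.V ?t)"
      using map t unfolding banach_bundle_map_def by blast
    then have \<phi>x: "\<phi> x \<in> carrier (Y.V ?t)" using xc by blast
    have NX: "X.N (c \<odot>\<^bsub>X.V ?t\<^esub> x) = cmod c * X.N x" if "c \<in> K" for c
      using X.normed_fiber[OF t(1)] xc that unfolding normed_space_over_def by blast
    have NY: "Y.N (c \<odot>\<^bsub>Y.V ?t\<^esub> \<phi> x) = cmod c * Y.N (\<phi> x)" if "c \<in> K" for c
      using Y.normed_fiber[OF t(2)] \<phi>x that unfolding normed_space_over_def by blast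
    have \<phi>c: "\<phi> (c \<odot>\<^bsub>X.V ?t\<^esub> x) = c \<odot>\<^bsub>Y.V ?t\<^esub> \<phi> x" if "c \<in> K" for c
      using map t xc that unfolding banach_bundle_map_def by blast
    have scaled: "r * Y.N (\<phi> x) \<le> B" if "r \<ge> 0" "r * X.N x \<le> 1" for r
    proof -
      have "Y.N (\<phi> (complex_of_real r \<odot>\<^bsub>X.V ?t\<^esub> x)) \<le> B"
        using X.smult_in(1)[OF X.of_real_scalars x refl] NX[OF X.of_real_scalars] that by (intro unit) simp_all
      then show ?thesis using \<phi>c[OF X.of_real_scalars] NY[OF X.of_real_scalars] that(1) by simp
    qed
    have NN: "X.N x \<ge> 0" by (rule X.N_nonneg[OF x])
    show ?thesis
    proof (cases "X.N x = 0")
      case True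
      \<comment> \<open>All nonnegative multiples of a vector of norm 0 lie in the unit ball, so the
        multiples of \<open>Y.N (\<phi> x)\<close> are all bounded by \<open>B\<close>; the factor
        below pushes one of them to \<open>B + 1\<close>.\<close>
      have "Y.N (\<phi> x) \<le> 0"
      proof (rule ccontr)
        assume "\<not> Y.N (\<phi> x) \<le> 0"
        then show False using scaled[of "(B + 1) / Y.N (\<phi> x)"] True B by simp
      qed
      then show ?thesis using True by simp
    next
      case False
      then show ?thesis using scaled[of "1 / X.N x"] NN by (simp add: field_simps)
    qed
  qed
  then show ?thesis using B by blast
qed

theorem theorem3p8:
  fixes K :: "complex set"
    and T :: "'t topology"
    and \<xi>1 :: "('t, 'e1) bundle_data"
    and \<xi>2 :: "('t, 'e2) bundle_data"
    and \<phi> :: "'e1 \<Rightarrow> 'e2"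
  assumes "K = \<real> \<or> K = UNIV"
    and "locally_compact_space T" and "Hausdorff_space T"
    and "base_space \<xi>1 = T" and "base_space \<xi>2 = T"
    and "banach_bundle K \<xi>1"
    and "continuous_banach_bundle K \<xi>2"
    and "banach_bundle_map K \<xi>1 \<xi>2 \<phi>"
    and "\<phi> ` topspace (bundle_space \<xi>1) = topspace (bundle_space \<xi>2)"
    and "(SUP t \<in> topspace T. fiber_onorm \<xi>1 \<xi>2 \<phi> t) < \<infinity>"
    and "\<exists>m>0. \<forall>y \<in> topspace (bundle_space \<xi>2). \<exists>x \<in> topspace (bundle_space \<xi>1).
           \<phi> x = y \<and> fnorm \<xi>1 x \<le> m * fnorm \<xi>2 y"
  shows "induced_map \<xi>1 \<phi> ` Gamma0 \<xi>1 = Gamma0 \<xi>2"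
proof -
  have b2: "banach_bundle K \<xi>2" and c2: "continuous_map (bundle_space \<xi>2) euclideanreal (fnorm \<xi>2)"
    using assms(7) by (auto simp: continuous_banach_bundle_def)
  have base: "base_space \<xi>2 = base_space \<xi>1" using assms(4,5) by simp
  obtain B where B: "B > 0" "\<And>x. x \<in> topspace (bundle_space \<xi>1) \<Longrightarrow> fnorm \<xi>2 (\<phi> x) \<le> B * fnorm \<xi>1 x"
    using fiber_onorm_bound[OF assms(6,1) b2 base assms(8)] assms(4,10) by auto
  obtain m where m: "m > 0" "\<And>y. y \<in> topspace (bundle_space \<xi>2) \<Longrightarrow>
      \<exists>x \<in> topspace (bundle_space \<xi>1). \<phi> x = y \<and> fnorm \<xi>1 x \<le> m * fnorm \<xi>2 y"
    using assms(11) by blast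
  interpret surjective_bundle_map K \<xi>1 \<xi>2 \<phi> m B
    using assms(1,6,8) b2 c2 base B m by unfold_locales
  \<comment> \<open>Local compactness and the Hausdorff property supply the bump functions through
    complete regularity.\<close>
  have reg: "completely_regular_space X.T"
    using assms(2,3,4) locally_compact_regular_imp_completely_regular_space
      locally_compact_Hausdorff_imp_regular_space by blast
  show ?thesis
  proof
    show "induced_map \<xi>1 \<phi> ` Gamma0 \<xi>1 \<subseteq> Gamma0 \<xi>2" using map_sections by blast
    show "Gamma0 \<xi>2 \<subseteq> induced_map \<xi>1 \<phi> ` Gamma0 \<xi>1"
    proof
      fix g assume g: "g \<in> Gamma0 \<xi>2"
      then have g': "continuous_map X.T Y.E g" "\<And>t. t \<in> topspace X.T \<Longrightarrow> Y.p (g t) = t"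
        "\<And>e. e > 0 \<Longrightarrow> compactin X.T {t \<in> topspace X.T. e \<le> Y.N (g t)}" "g \<in> extensional (topspace X.T)"
        by (simp_all add: Gamma0_def bundle_sections_def base)
      obtain f where f: "f \<in> Gamma0 \<xi>1" "\<forall>t\<in>topspace X.T. \<phi> (f t) = g t"
        using lift_section[OF g'(1,2) reg g'(3)] by blast
      have "g = induced_map \<xi>1 \<phi> f"
        using f(2) g'(4) by (auto simp: induced_map_def extensional_def fun_eq_iff)
      then show "g \<in> induced_map \<xi>1 \<phi> ` Gamma0 \<xi>1" using f(1) by blast
    qed
  qed
qed

end
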